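(* For each slot $k\in S\setminus\{2n-2\}$ and all distinct teams $i,j,t\in V$, both inequalities $$x_{k,j,t}+x_{k,i,t}+x_{k+1,j,t}-1\le y_{t,i,j}\qquad\text{and}\qquad x_{k+1,i,t}+x_{k,i,t}+x_{k+1,j,t}-1\le y_{t,i,j}$$ are facet-defining for $P_{\mathrm{utt}}(n)$.
   Context: Let $n\ge4$ be even, $V=\{1,\dots,n\}$ (teams; team $i$ has home venue $i$), $S=\{1,\dots,2n-2\}$ (slots), $A=\{(i,j)\in V\times V:i\ne j\}$, $\mathcal M=\{(k,i,j):k\in S,(i,j)\in A\}$, where $(k,i,j)$ denotes the match between $i$ and $j$ at venue $i$ in slot $k$. Coordinates are $x_{k,i,j}$ ($(k,i,j)\in\mathcal M$) and $y_{t,i,j}$ ($t\in V$, $(i,j)\in A$). A tournament is a set $T\subseteq\mathcal M$ whose incidence vector $x=\chi(T)\in\{0,1\}^{\mathcal M}$ satisfies $\sum_{j\in V\setminus\{i\}}(x_{k,i,j}+x_{k,j,i})=1$ for all $k\in S$, $k\ge2$, $i\in V$, and $\sum_{k\in S}x_{k,i,j}=1$ for all $(i,j)\in A$. In $T$, team $t$ is at venue $t$ in a slot where it plays at home and at venue $i$ in slot $k$ if $(k,i,t)\in T$; before slot 1 and after slot $2n-2$ it is at venue $t$. Team $t$ travels from venue $i$ to venue $j\ne i$ if it is at $i$ and then at $j$ at consecutive positions of (start, slot $1$, …, slot $2n-2$, end). The travel vector $\psi(T)\in\{0,1\}^{V\times A}$ has $\psi(T)_{t,i,j}=1$ iff team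 $t$ travels from $i$ to $j$. $P_{\mathrm{utt}}(n)=\mathrm{conv}\{(\chi(T),y)\in\{0,1\}^{\mathcal M}\times\{0,1\}^{V\times A}: T\text{ tournament},\ y\ge\psi(T)\}$. An inequality is facet-defining if it is valid and the face it induces is a facet. *)

theory Defs
  imports "HOL-Analysis.Analysis"
begin

definition teams :: "nat \<Rightarrow> nat set" where
  "teams n = {1..n}"

definition slots :: "nat \<Rightarrow> nat set" where
  "slots n = {1..2 * n - 2}"

definition arcs :: "nat \<Rightarrow> (nat \<times> nat) set" where
  "arcs n = {(i, j). i \<in> teams n \<and> j \<in> teams n \<and> i \<noteq> j}"

text \<open>The triple \<open>(k, i, j)\<close> is the match between \<open>i\<close> and \<open>j\<close> at venue \<open>i\<close> in slot \<open>k\<close>.\<close>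

definition matches :: "nat \<Rightarrow> (nat \<times> nat \<times> nat) set" where
  "matches n = slots n \<times> arcs n"

definition tournament :: "nat \<Rightarrow> (nat \<times> nat \<times> nat) set \<Rightarrow> bool" where
  "tournament n T \<longleftrightarrow>
     T \<subseteq> matches n \<and>
     (\<forall>k\<in>slots n. 2 \<le> k \<longrightarrow> (\<forall>i\<in>teams n.
        (\<Sum>j\<in>teams n - {i}. indicator T (k, i, j) + indicator T (k, j, i)) = (1::real))) \<and>
     (\<forall>(i, j)\<in>arcs n. (\<Sum>k\<in>slots n. indicator T (k, i, j)) = (1::real))"

text \<open>Positions \<open>0\<close> and \<open>2 * n - 1\<close> stand for the start before the first slot and the end after
  the last one. In a tournament every team is at exactly one venue at each position.\<close>

definition at_venue :: "nat \<Rightarrow> (nat \<times> nat \<times> nat) set \<Rightarrow> nat \<Rightarrow> nat \<Rightarrow> nat \<Rightarrow> bool" where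
  "at_venue n T t p i \<longleftrightarrow>
     (if p \<in> slots n then (i = t \<and> (\<exists>j. (p, t, j) \<in> T)) \<or> (p, i, t) \<in> T else i = t)"

definition travels :: "nat \<Rightarrow> (nat \<times> nat \<times> nat) set \<Rightarrow> nat \<Rightarrow> nat \<Rightarrow> nat \<Rightarrow> bool" where
  "travels n T t i j \<longleftrightarrow>
     i \<noteq> j \<and> (\<exists>p\<in>{0..2 * n - 2}. at_venue n T t p i \<and> at_venue n T t (p + 1) j)"

text \<open>The two coordinate index sets as finite types, where the number of teams is the cardinality
  of the type parameter. The class \<open>card2\<close> (at least two elements) makes them nonempty.\<close>

typedef (overloaded) ('n::card2) match_idx = "matches CARD('n)"
proof
  show "(1, 1, 2) \<in> matches CARD('n)"
    using two_le_card[where 'a='n] by (auto simp: matches_def slots_def arcs_def teams_def)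
qed

typedef (overloaded) ('n::card2) travel_idx = "teams CARD('n) \<times> arcs CARD('n)"
proof
  show "(1, 1, 2) \<in> teams CARD('n) \<times> arcs CARD('n)"
    using two_le_card[where 'a='n] by (auto simp: arcs_def teams_def)
qed

lemma finite_arcs: "finite (arcs n)"
  by (rule finite_subset[of _ "teams n \<times> teams n"]) (auto simp: arcs_def teams_def)

instance match_idx :: (card2) finite
proof
  have "UNIV = (Abs_match_idx ` matches CARD('a) :: 'a match_idx set)"
    by (metis type_definition.Abs_image type_definition_match_idx)
  then show "finite (UNIV :: 'a match_idx set)"
    by (metis matches_def slots_def finite_arcs finite_cartesian_product finite_atLeastAtMost
        finite_imageI)
qed

instance travel_idx :: (card2) finite
proof
  have "UNIV = (Abs_travel_idx ` (teams CARD('a) \<times> arcs CARD('a)) :: 'a travel_idx set)"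
    by (metis type_definition.Abs_image type_definition_travel_idx)
  then show "finite (UNIV :: 'a travel_idx set)"
    by (metis teams_def finite_arcs finite_cartesian_product finite_atLeastAtMost finite_imageI)
qed

type_synonym 'n utt_space = "(real ^ 'n match_idx) \<times> (real ^ 'n travel_idx)"

text \<open>The coordinates \<open>x\<^bsub>k,i,j\<^esub>\<close> and \<open>y\<^bsub>t,i,j\<^esub>\<close>; meaningful only for \<open>(k, i, j)\<close> in
  \<open>matches CARD('n)\<close> and \<open>(t, i, j)\<close> in \<open>teams CARD('n) \<times> arcs CARD('n)\<close>.\<close>

definition x_coord :: "('n::card2) utt_space \<Rightarrow> nat \<Rightarrow> nat \<Rightarrow> nat \<Rightarrow> real" where
  "x_coord z k i j = fst z $ Abs_match_idx (k, i, j)"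

definition y_coord :: "('n::card2) utt_space \<Rightarrow> nat \<Rightarrow> nat \<Rightarrow> nat \<Rightarrow> real" where
  "y_coord z t i j = snd z $ Abs_travel_idx (t, i, j)"

definition incidence_vec :: "(nat \<times> nat \<times> nat) set \<Rightarrow> real ^ ('n::card2) match_idx" where
  "incidence_vec T = (\<chi> m. indicator T (Rep_match_idx m))"

definition travel_vec :: "(nat \<times> nat \<times> nat) set \<Rightarrow> real ^ ('n::card2) travel_idx" where
  "travel_vec T = (\<chi> l. case Rep_travel_idx l of (t, i, j) \<Rightarrow> of_bool (travels CARD('n) T t i j))"

definition P_utt :: "('n::card2) utt_space set" where
  "P_utt = convex hull
     {(incidence_vec T, y) | T y. tournament CARD('n) T \<and>
        (\<forall>l. y $ l \<in> {0, 1}) \<and> (\<forall>l. travel_vec T $ l \<le> y $ l)}"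

text \<open>The inequality \<open>f z \<le> g z\<close>, where \<open>f\<close> and \<open>g\<close> are meant to be affine, is facet-defining
  for \<open>P\<close>.\<close>

definition facet_defining :: "'a::euclidean_space set \<Rightarrow> ('a \<Rightarrow> real) \<Rightarrow> ('a \<Rightarrow> real) \<Rightarrow> bool" where
  "facet_defining P f g \<longleftrightarrow>
     (\<forall>z\<in>P. f z \<le> g z) \<and> {z \<in> P. f z = g z} facet_of P"

end

theory Submission
  imports Defs
begin

text \<open>
  A schedule is a proper arc colouring of the complete digraph on the teams with \<open>2 * n - 2\<close>
  colours, the slots. Two one-factorizations of the complete graph with arbitrary orientation and
  slot assignment yield enough schedules for the following duality argument. A hyperplane that
  contains the face and one further point of the polytope has no \<open>y\<close> part, since every
  travel can be avoided by a schedule on the face. Exchanging the venues of the two matches between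
  two teams, or the slots of the four matches along a 4-cycle, changes schedules on the face into
  schedules on the face; this forces the \<open>x\<close> part to be of the form
  \<open>u k p + u k q + v p q\<close>, hence constant on all tournaments.
\<close>

subsection \<open>Schedules from one-factorizations\<close>

text \<open>The dimension of the polytope is never computed: it suffices that the face and one point
  off it affinely span a set containing the polytope. Write the left side as x(K,J,t) + x(K,I,t) +
  x(L,J,t) - 1 with \<open>K\<close>, \<open>L\<close> adjacent. The obstacle is that every exchange
  must start and end on the face. Whether it does depends on when \<open>t\<close> visits
  \<open>I\<close> and \<open>J\<close>, so one visit is pinned: \<open>I\<close> in slot
  \<open>K\<close>, or \<open>J\<close> in slot \<open>L\<close>. A pinned match blocks its slot for
  all matches sharing a team with it, and cannot be exchanged itself. Comparisons blocked by one pin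
  use the other pin or pass through a third slot; the pinned pairs themselves use the third way of
  being on the face, \<open>J\<close> in slot \<open>K\<close> without \<open>I\<close> in the
  neighbouring slot \<open>R\<close>. Each exchange thus prescribes only a handful of matches. The
  two legs of the double round robin make this easy: matches prescribed in different legs only need
  distinct slots.\<close>

definition one_factorization :: "nat \<Rightarrow> (nat \<Rightarrow> nat \<Rightarrow> nat) \<Rightarrow> bool" where
  "one_factorization n c \<longleftrightarrow>
     (\<forall>p\<in>teams n. \<forall>q\<in>teams n. p \<noteq> q \<longrightarrow> c p q = c q p \<and> c p q < n - 1) \<and>
     (\<forall>p\<in>teams n. inj_on (c p) (teams n - {p}))"

text \<open>The circle method.\<close>

lemma one_factorization_exists:
  assumes "even n" "2 \<le> n"
  shows "\<exists>c. one_factorization n c"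
proof -
  define N where "N = n - 1"
  have N: "odd N" "N \<ge> 1" "n = N + 1" using assms by (auto simp: N_def)
  \<comment> \<open>Teams other than \<open>n\<close> are residues modulo the odd number
    \<open>N\<close>. The sums p + q with q different from p miss exactly 2p, and this colour goes
    to the edge from p to \<open>n\<close>.\<close>
  define c where "c = (\<lambda>p q. if p = n then 2 * q mod N else if q = n then 2 * p mod N
    else (p + q) mod N)"
  have dvd: "x = y" if "x \<in> {1..N}" "y \<in> {1..N}" "N dvd y - x" "x \<le> y" for x y :: nat
  proof (rule ccontr)
    assume "x \<noteq> y"
    then have "N \<le> y - x" using that by (intro dvd_imp_le) auto
    then show False using that \<open>x \<noteq> y\<close> by auto
  qed
  have add: "x = y" if "x \<in> {1..N}" "y \<in> {1..N}" "(p + x) mod N = (p + y) mod N" for p x y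
  proof -
    have "x = y" if "x \<in> {1..N}" "y \<in> {1..N}" "(p + x) mod N = (p + y) mod N" "x \<le> y" for x y
      using that mod_eq_dvd_iff_nat[of "p + x" "p + y" N] by (intro dvd[of x y]) simp_all
    then show ?thesis using that by (metis nle_le)
  qed
  have dbl: "x = y" if "x \<in> {1..N}" "y \<in> {1..N}" "2 * x mod N = 2 * y mod N" for x y
  proof -
    have "x = y" if "x \<in> {1..N}" "y \<in> {1..N}" "2 * x mod N = 2 * y mod N" "x \<le> y" for x y
    proof (rule dvd)
      have "N dvd 2 * (y - x)"
        using that mod_eq_dvd_iff_nat[of "2 * x" "2 * y" N] by (auto simp: diff_mult_distrib2)
      then show "N dvd y - x" using N(1) by (simp add: coprime_dvd_mult_right_iff)
    qed (use that in auto)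
    then show ?thesis using that by (metis nle_le)
  qed
  have "one_factorization n c"
    unfolding one_factorization_def
  proof (intro conjI ballI impI)
    fix p q assume *: "p \<in> teams n" "q \<in> teams n" "p \<noteq> q"
    show "c p q = c q p" using * by (simp add: c_def add.commute)
    show "c p q < n - 1" using N by (simp add: c_def)
  next
    fix p assume p: "p \<in> teams n"
    show "inj_on (c p) (teams n - {p})"
    proof (rule inj_onI)
      fix x y assume xy: "x \<in> teams n - {p}" "y \<in> teams n - {p}" and eq: "c p x = c p y"
      show "x = y"
      proof (cases "p = n")
        case True
        then have "x \<in> {1..N}" "y \<in> {1..N}" "2 * x mod N = 2 * y mod N"
          using xy eq N(3) by (auto simp: c_def teams_def)
        then show ?thesis by (rule dbl)
      next
        case pn: False
        then have pN: "p \<in> {1..N}" using p N by (auto simp: teams_def)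
        have mem: "z \<in> {1..N}" if "z \<in> teams n - {p}" "z \<noteq> n" for z
          using that N by (auto simp: teams_def)
        have cn: "c p n = (p + p) mod N" using pn by (simp add: c_def mult_2)
        have cz: "c p z = (p + z) mod N" if "z \<noteq> n" for z using pn that by (simp add: c_def)
        consider "x = n" "y = n" | "x = n" "y \<noteq> n" | "x \<noteq> n" "y = n" | "x \<noteq> n" "y \<noteq> n" by blast
        then show ?thesis
        proof cases
          case 2
          then have "p = y" using eq xy cn cz[of y] add[OF pN mem[of y], of p] by simp
          then show ?thesis using xy by simp
        next
          case 3
          then have "p = x" using eq xy cn cz[of x] add[OF pN mem[of x], of p] by simp
          then show ?thesis using xy by simp
        next
          case 4
          then show ?thesis using eq xy cz[of x] cz[of y] add[OF mem[of x] mem[of y], of p] by simp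
        qed simp
      qed
    qed
  qed
  then show ?thesis by blast
qed

lemma one_factorization_color:
  assumes "one_factorization n c" "p \<in> teams n" "q \<in> teams n" "p \<noteq> q"
  shows "c p q = c q p" "c p q < n - 1"
  using assms unfolding one_factorization_def by blast+

lemma one_factorization_inject:
  assumes "one_factorization n c" "c p x = c p y" "p \<in> teams n" "x \<in> teams n - {p}" "y \<in> teams n - {p}"
  shows "x = y"
  using assms unfolding one_factorization_def inj_on_def by blast

lemma one_factorization_partner:
  assumes c: "one_factorization n c" and b: "b \<in> teams n" and g: "g < n - 1"
  shows "\<exists>x\<in>teams n - {b}. c b x = g"
proof -
  have "c b ` (teams n - {b}) = {..<n - 1}"
  proof (rule card_subset_eq)
    show "c b ` (teams n - {b}) \<subseteq> {..<n - 1}"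
      using one_factorization_color(2)[OF c b] by auto
    have "inj_on (c b) (teams n - {b})"
      using c b unfolding one_factorization_def by blast
    then show "card (c b ` (teams n - {b})) = card {..<n - 1}"
      using b by (simp add: card_image teams_def)
  qed simp
  then show ?thesis using g by (metis imageE lessThan_iff)
qed

lemma one_factorization_relabel:
  assumes c: "one_factorization n c" and h: "bij_betw h (teams n) (teams n)"
  shows "one_factorization n (\<lambda>p q. c (h p) (h q))"
  unfolding one_factorization_def
proof (intro conjI ballI impI)
  have mem: "h p \<in> teams n" if "p \<in> teams n" for p using h that by (auto simp: bij_betw_def)
  have inj: "inj_on h (teams n)" using h by (auto simp: bij_betw_def)
  { fix p q assume pq: "p \<in> teams n" "q \<in> teams n" "p \<noteq> q"
    then have "h p \<noteq> h q" using inj by (auto dest: inj_onD)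
    then show "c (h p) (h q) = c (h q) (h p)" "c (h p) (h q) < n - 1"
      using c pq mem unfolding one_factorization_def by blast+ }
  fix p assume p: "p \<in> teams n"
  have "inj_on (c (h p)) (teams n - {h p})"
    using c p mem unfolding one_factorization_def by blast
  moreover have "h ` (teams n - {p}) \<subseteq> teams n - {h p}"
    using mem inj p by (auto dest: inj_onD)
  ultimately have "inj_on (c (h p) \<circ> h) (teams n - {p})"
    using inj by (meson Diff_subset comp_inj_on inj_on_subset)
  then show "inj_on (\<lambda>q. c (h p) (h q)) (teams n - {p})" by (simp add: o_def)
qed

text \<open>Any factorization will do after relabelling: if \<open>x\<close> is the partner of
  \<open>b\<close> in the colour of the edge ta, exchanging the names of \<open>x\<close> and
  \<open>d\<close> makes \<open>d\<close> that partner and leaves \<open>t\<close>,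
  \<open>a\<close>, \<open>b\<close> alone.\<close>

lemma one_factorization_same_class:
  assumes n: "even n" "2 \<le> n"
    and d: "{t, a, b, d} \<subseteq> teams n" "distinct [t, a, b, d]"
  shows "\<exists>c. one_factorization n c \<and> c t a = c b d"
proof -
  obtain c where c: "one_factorization n c" using one_factorization_exists[OF n] by blast
  note sym = one_factorization_color(1)[OF c] and inj = one_factorization_inject[OF c]
  have "c t a < n - 1" using one_factorization_color(2)[OF c, of t a] d by auto
  then obtain x where x: "x \<in> teams n" "x \<noteq> b" "c b x = c t a"
    using one_factorization_partner[OF c, of b "c t a"] d by auto
  \<comment> \<open>Otherwise \<open>t\<close> or \<open>a\<close> would have two edges of one
    colour.\<close>
  have "x \<noteq> t" using x d sym[of b t] inj[of t b a] by auto
  moreover have "x \<noteq> a" using x d sym[of b a] sym[of t a] inj[of a b t] by auto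
  ultimately have nx: "x \<noteq> t" "x \<noteq> a" .
  define h where "h = Transposition.transpose x d"
  have "bij_betw h (teams n) (teams n)"
    unfolding h_def using x d by (intro permutes_imp_bij permutes_swap_id) auto
  then have "one_factorization n (\<lambda>p q. c (h p) (h q))"
    by (rule one_factorization_relabel[OF c])
  moreover have "c (h t) (h a) = c (h b) (h d)"
    using nx x d by (auto simp: h_def transpose_eq_iff)
  ultimately show ?thesis by blast
qed

section \<open>Schedules with a few prescribed matches\<close>

definition incident :: "(nat \<Rightarrow> nat \<Rightarrow> nat) \<Rightarrow> nat \<Rightarrow> bool \<times> nat \<Rightarrow> nat" where
  "incident s p = (\<lambda>(b, q). if b then s p q else s q p)"

text \<open>\<open>s p q\<close> is the slot of the match at venue \<open>p\<close> against
  \<open>q\<close>. Home and away together, a team has 2n - 2 matches, as many as there are slots,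
  so injectivity already fills every slot.\<close>

definition schedule :: "nat \<Rightarrow> (nat \<Rightarrow> nat \<Rightarrow> nat) \<Rightarrow> bool" where
  "schedule n s \<longleftrightarrow> (\<forall>p\<in>teams n. inj_on (incident s p) (UNIV \<times> (teams n - {p})) \<and>
     incident s p ` (UNIV \<times> (teams n - {p})) \<subseteq> slots n)"

text \<open>A partial bijection leaves equally many unmatched elements on both sides; any bijection
  between the rests completes it.\<close>

lemma bij_betw_extend:
  assumes "finite A" "card A = card B" "finite B" "G \<subseteq> A \<times> B"
    and G: "\<And>x y x' y'. (x, y) \<in> G \<Longrightarrow> (x', y') \<in> G \<Longrightarrow> x = x' \<longleftrightarrow> y = y'"
  shows "\<exists>h. bij_betw h A B \<and> (\<forall>(x, y)\<in>G. h x = y)"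
proof -
  have "inj_on fst G" "inj_on snd G" using G by (auto simp: inj_on_def)
  then have c: "card (fst ` G) = card (snd ` G)" by (simp add: card_image)
  have sub: "fst ` G \<subseteq> A" "snd ` G \<subseteq> B" using assms(4) by auto
  have "card (A - fst ` G) = card (B - snd ` G)"
    using sub c assms by (simp add: card_Diff_subset finite_subset)
  then obtain f where f: "bij_betw f (A - fst ` G) (B - snd ` G)"
    using assms by (metis finite_Diff finite_same_card_bij)
  define g where "g = (\<lambda>x. THE y. (x, y) \<in> G)"
  have g: "g x = y" if "(x, y) \<in> G" for x y
    unfolding g_def using that G by (intro the_equality) auto
  have "bij_betw g (fst ` G) (snd ` G)"
    unfolding bij_betw_def inj_on_def using g G by (force simp: image_iff)
  then have "bij_betw (\<lambda>x. if x \<in> fst ` G then g x else f x) (fst ` G \<union> (A - fst ` G))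
      (snd ` G \<union> (B - snd ` G))"
    using f by (intro bij_betw_disjoint_Un) auto
  moreover have "fst ` G \<union> (A - fst ` G) = A" "snd ` G \<union> (B - snd ` G) = B" using sub by auto
  ultimately show ?thesis using g by (intro exI conjI) (auto simp: image_iff, force)
qed

text \<open>The first one-factorization is played along the orientation extending \<open>B\<close>, the second one
  against it; \<open>G\<close> prescribes the slots of some of the \<open>2 * n - 2\<close> factors.\<close>

lemma schedule_exists:
  assumes c: "one_factorization n c1" "one_factorization n c2"
    and B: "\<And>p q. (p, q) \<in> B \<Longrightarrow> (q, p) \<notin> B"
    and G: "G \<subseteq> (UNIV \<times> {..<n - 1}) \<times> slots n"
      "\<And>x y x' y'. (x, y) \<in> G \<Longrightarrow> (x', y') \<in> G \<Longrightarrow> x = x' \<longleftrightarrow> y = y'"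
  shows "\<exists>s. schedule n s \<and> (\<forall>p q g. (p, q) \<in> B \<longrightarrow>
    (((True, c1 p q), g) \<in> G \<longrightarrow> s p q = g) \<and> (((False, c2 p q), g) \<in> G \<longrightarrow> s q p = g))"
proof -
  let ?K = "(UNIV :: bool set) \<times> {..<n - 1}"
  have "card ?K = card (slots n)" by (simp add: slots_def card_cartesian_product)
  moreover have "finite ?K" "finite (slots n)" by (simp_all add: slots_def)
  ultimately have "\<exists>h. bij_betw h ?K (slots n) \<and> (\<forall>(x, y)\<in>G. h x = y)"
    using G by (intro bij_betw_extend) simp_all
  then obtain h where h: "bij_betw h ?K (slots n)" and "\<forall>(x, y)\<in>G. h x = y" by (elim exE conjE)
  then have hG: "h x = y" if "(x, y) \<in> G" for x y using that by fast
  define or where "or p q \<longleftrightarrow> (p, q) \<in> B \<or> (p < q \<and> (q, p) \<notin> B)" for p q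
  have or: "or p q \<longleftrightarrow> \<not> or q p" if "p \<noteq> q" for p q
    using that B[of p q] B[of q p] by (auto simp: or_def)
  have orB: "or p q" if "(p, q) \<in> B" for p q using that by (simp add: or_def)
  define s where "s p q = (if or p q then h (True, c1 p q) else h (False, c2 q p))" for p q
  \<comment> \<open>A match of \<open>p\<close> is in the first leg iff hosting agrees with the
    orientation. Leg and colour together name its factor, and different matches of \<open>p\<close>
    lie in different factors.\<close>
  define key where "key p = (\<lambda>(b, q). (b = or p q, if b = or p q then c1 p q else c2 p q))" for p
  note sym = one_factorization_color(1)[OF c(1)] one_factorization_color(1)[OF c(2)]
    one_factorization_color(2)[OF c(1)] one_factorization_color(2)[OF c(2)]
  have inj: "x = y" if "p \<in> teams n" "x \<in> teams n - {p}" "y \<in> teams n - {p}"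
    "c1 p x = c1 p y \<or> c2 p x = c2 p y" for p x y
    using that one_factorization_inject[OF c(1), of p x y] one_factorization_inject[OF c(2), of p x y]
    by blast
  have "schedule n s"
    unfolding schedule_def
  proof (intro ballI)
    fix p assume p: "p \<in> teams n"
    let ?D = "UNIV \<times> (teams n - {p})"
    have eq: "incident s p x = (h \<circ> key p) x" if "x \<in> ?D" for x
    proof -
      obtain b q where "x = (b, q)" by fastforce
      with that have x: "x = (b, q)" "q \<in> teams n" "q \<noteq> p" by auto
      have "c1 q p = c1 p q" "c2 q p = c2 p q" "or q p = (\<not> or p q)"
        using sym(1,2)[OF p x(2)] x(3) or[of p q] by auto
      then show ?thesis by (simp add: x incident_def key_def s_def)
    qed
    have "inj_on (key p) ?D"
    proof (rule inj_onI)
      fix x y assume xy: "x \<in> ?D" "y \<in> ?D" and eq: "key p x = key p y"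
      obtain b q b' q' where x: "x = (b, q)" "y = (b', q')" by fastforce
      then have q: "q \<in> teams n - {p}" "q' \<in> teams n - {p}" using xy by auto
      have "(b = or p q) = (b' = or p q')" "c1 p q = c1 p q' \<or> c2 p q = c2 p q'"
        using eq by (auto simp: x key_def split: if_splits)
      then show "x = y" using inj[OF p q] x by auto
    qed
    moreover have key: "key p ` ?D \<subseteq> ?K" using sym(3,4) p by (auto simp: key_def)
    ultimately have "inj_on (h \<circ> key p) ?D"
      using h by (meson bij_betw_def comp_inj_on inj_on_subset)
    moreover have "(h \<circ> key p) ` ?D \<subseteq> slots n"
      using key h unfolding bij_betw_def image_comp[symmetric] by blast
    ultimately show "inj_on (incident s p) ?D \<and> incident s p ` ?D \<subseteq> slots n"
      using eq by (metis (no_types, lifting) image_cong inj_on_cong)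
  qed
  moreover have "(((True, c1 p q), g) \<in> G \<longrightarrow> s p q = g) \<and> (((False, c2 p q), g) \<in> G \<longrightarrow> s q p = g)"
    if "(p, q) \<in> B" for p q g
  proof -
    have "or p q" "\<not> or q p" using orB[OF that] or[of p q] B[OF that] that by metis+
    then show ?thesis by (simp add: s_def hG)
  qed
  ultimately show ?thesis by blast
qed

text \<open>Different edges with a common team have different colours, so the three matches lie in
  three factors, two of the first leg and one of the second, which may receive any distinct
  slots.\<close>

lemma schedule_share_vertex:
  assumes n: "even n" "4 \<le> n"
    and m: "{p, q, x, y} \<subseteq> teams n" "p \<noteq> q" "x \<noteq> y" "{p, q} \<noteq> {x, y}" "{p, q} \<inter> {x, y} \<noteq> {}"
    and g: "{e, f, g} \<subseteq> slots n" "distinct [e, f, g]"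
  shows "\<exists>s. schedule n s \<and> s p q = e \<and> s q p = f \<and> s x y = g"
proof -
  obtain c where c: "one_factorization n c" using one_factorization_exists[OF n(1)] n(2) by auto
  note sym = one_factorization_color[OF c]
  have inj: "c a u \<noteq> c a v" if "a \<in> teams n" "u \<in> teams n - {a}" "v \<in> teams n - {a}" "u \<noteq> v" for a u v
    using that one_factorization_inject[OF c, of a u v] by blast
  have ne: "c p q \<noteq> c x y"
  proof -
    consider "x = p" | "x = q" | "y = p" | "y = q" using m(5) by blast
    then show ?thesis
    proof cases
      case 1
      then show ?thesis using m inj[of p q y] by auto
    next
      case 2
      then show ?thesis using m inj[of q p y] sym(1)[of p q] by auto
    next
      case 3
      then show ?thesis using m inj[of p q x] sym(1)[of x y] by auto
    next
      case 4
      then show ?thesis using m inj[of q p x] sym(1)[of p q] sym(1)[of x y] by auto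
    qed
  qed
  show ?thesis
  proof (rule exE[OF schedule_exists[OF c c, of "{(p, q), (x, y)}"
      "{((True, c p q), e), ((False, c p q), f), ((True, c x y), g)}"]], goal_cases)
    case (1 p q)
    then show ?case using m by auto
  next
    case 2
    then show ?case using m g ne sym(2) by auto
  next
    case (3 x y x' y')
    then show ?case using g ne sym(2) by auto
  next
    case (4 s)
    then show ?case using ne sym(2) by (intro exI[of _ s]) simp
  qed
qed

text \<open>Needed when an exchanged match is played in the very slot of the pinned one: disjoint
  edges can be put into a common colour class.\<close>

lemma schedule_disjoint_edges:
  assumes n: "even n" "4 \<le> n"
    and m: "{p, q, x, y} \<subseteq> teams n" "distinct [p, q, x, y]"
    and g: "{e, f} \<subseteq> slots n" "e \<noteq> f"
  shows "\<exists>s. schedule n s \<and> s p q = e \<and> s q p = f \<and> s x y = e"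
proof -
  obtain c where c: "one_factorization n c" and eq: "c p q = c x y"
    using one_factorization_same_class[OF _ _ m] n by auto
  have lt: "c x y < n - 1" using one_factorization_color(2)[OF c, of x y] m by auto
  show ?thesis
  proof (rule exE[OF schedule_exists[OF c c, of "{(p, q), (x, y)}"
      "{((True, c p q), e), ((False, c p q), f)}"]], goal_cases)
    case (1 p q)
    then show ?case using m by auto
  next
    case 2
    then show ?case using m g eq lt by auto
  next
    case (3 x y x' y')
    then show ?case using g eq by auto
  next
    case (4 s)
    then show ?case using eq by (intro exI[of _ s]) simp
  qed
qed

text \<open>The two visits of \<open>t'\<close> go to the second leg, where they differ in colour
  because they share \<open>t'\<close>; the match \<open>(h, t)\<close> goes to the first leg and so
  cannot collide with them.\<close>

lemma schedule_three_arcs: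
  assumes n: "even n" "4 \<le> n"
    and m: "{h, t, y, x, t'} \<subseteq> teams n" "h \<noteq> t" "distinct [t', x, y]" "(h, t) \<notin> {(y, t'), (x, t')}"
    and g: "{g, q, q'} \<subseteq> slots n" "distinct [g, q, q']"
  shows "\<exists>s. schedule n s \<and> s h t = g \<and> s y t' = q \<and> s x t' = q'"
proof -
  obtain c where c: "one_factorization n c" using one_factorization_exists[OF n(1)] n(2) by auto
  note lt = one_factorization_color(2)[OF c]
  have ne: "c t' x \<noteq> c t' y"
    using one_factorization_inject[OF c, of t' x y] m by auto
  show ?thesis
  proof (rule exE[OF schedule_exists[OF c c, of "{(h, t), (t', y), (t', x)}"
      "{((True, c h t), g), ((False, c t' y), q), ((False, c t' x), q')}"]], goal_cases)
    case (1 p q)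
    then show ?case using m by auto
  next
    case 2
    then show ?case using m g ne lt by auto
  next
    case (3 x y x' y')
    then show ?case using g ne lt by auto
  next
    case (4 s)
    then show ?case using ne lt by (intro exI[of _ s]) simp
  qed
qed

text \<open>Opposite edges of the cycle must share a slot. A relabelling forces only one such
  coincidence, so each leg gets its own factorization: ta and bd meet in the first leg, td and ab in
  the second.\<close>

lemma schedule_four_cycle:
  assumes n: "even n" "4 \<le> n"
    and m: "{t, a, b, d, x} \<subseteq> teams n" "distinct [t, a, b, d]" "x \<noteq> t"
    and g: "{e, f, g} \<subseteq> slots n" "distinct [e, f, g]"
  shows "\<exists>s. schedule n s \<and> s t a = e \<and> s b d = e \<and> s t d = f \<and> s a b = f \<and> s x t = g"
proof -
  obtain c1 where c1: "one_factorization n c1" and eq1: "c1 t a = c1 b d"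
    using one_factorization_same_class[of n t a b d] n m by auto
  obtain c2 where c2: "one_factorization n c2" and eq2: "c2 d t = c2 b a"
    using one_factorization_same_class[of n d t b a] n m by auto
  note lt = one_factorization_color(2)[OF c1] one_factorization_color(2)[OF c2]
    one_factorization_color(1)[OF c1] one_factorization_color(1)[OF c2]
  show ?thesis
  \<comment> \<open>For \<open>x = a\<close> the extra match is the return of a first-leg match and
    belongs to the second leg; in all other cases it is put into the first.\<close>
  proof (cases "x = a")
    case True
    have "c2 t a \<noteq> c2 t d"
      using one_factorization_inject[OF c2, of t a d] m by auto
    then have ne: "c2 t a \<noteq> c2 d t" using lt(4)[of t d] m by auto
    show ?thesis
    proof (rule exE[OF schedule_exists[OF c1 c2, of "{(t, a), (b, d), (d, t), (b, a)}"
          "{((True, c1 b d), e), ((False, c2 b a), f), ((False, c2 t a), g)}"]], goal_cases)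
        case (1 p q)
        then show ?case using m by auto
      next
        case 2
        then show ?case using m g eq1 eq2 ne lt(1,2) True by auto
      next
        case (3 x y x' y')
        then show ?case using g eq1 eq2 ne lt(1,2) True by auto
      next
        case (4 s)
        then show ?case using eq1 eq2 ne lt(1,2) True by (intro exI[of _ s]) simp
      qed
  next
    case False
    have "c1 t a \<noteq> c1 t x"
      using one_factorization_inject[OF c1, of t a x] m False by auto
    then have ne: "c1 b d \<noteq> c1 x t" using lt(3)[of t x] m eq1 by auto
    show ?thesis
    proof (rule exE[OF schedule_exists[OF c1 c2, of "{(t, a), (b, d), (d, t), (b, a), (x, t)}"
          "{((True, c1 b d), e), ((False, c2 b a), f), ((True, c1 x t), g)}"]], goal_cases)
        case (1 p q)
        then show ?case using m False by auto
      next
        case 2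
        then show ?case using m g eq1 eq2 ne lt(1,2) False by auto
      next
        case (3 x y x' y')
        then show ?case using g eq1 eq2 ne lt(1,2) False by auto
      next
        case (4 s)
        then show ?case using eq1 eq2 ne lt(1,2) False by (intro exI[of _ s]) simp
      qed
  qed
qed

subsection \<open>Exchanging venues and slots\<close>

lemma schedule_range:
  assumes "schedule n s" "(p, q) \<in> arcs n"
  shows "s p q \<in> slots n"
proof -
  have "incident s p ` (UNIV \<times> (teams n - {p})) \<subseteq> slots n" "q \<in> teams n - {p}"
    using assms by (auto simp: schedule_def arcs_def)
  then have "incident s p (True, q) \<in> slots n" by blast
  then show ?thesis by (simp add: incident_def)
qed

lemma schedule_inject:
  assumes "schedule n s" "p \<in> teams n" "x \<in> teams n - {p}" "y \<in> teams n - {p}"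
  shows "s p x = s p y \<Longrightarrow> x = y" "s x p = s y p \<Longrightarrow> x = y" "s p x \<noteq> s y p"
proof -
  have "inj_on (incident s p) (UNIV \<times> (teams n - {p}))"
    using assms unfolding schedule_def by blast
  from inj_onD[OF this] have *: "(b, x) = (b', y)"
    if "incident s p (b, x) = incident s p (b', y)" for b b'
    using that assms(3,4) by blast
  show "s p x = s p y \<Longrightarrow> x = y" "s x p = s y p \<Longrightarrow> x = y" "s p x \<noteq> s y p"
    using *[of True True] *[of False False] *[of True False] by (auto simp: incident_def)
qed

lemma schedule_eq_iff:
  assumes "schedule n s" "p \<in> teams n" "x \<in> teams n" "y \<in> teams n" "p \<noteq> x" "p \<noteq> y"
  shows "s p x = s p y \<longleftrightarrow> x = y" "s x p = s y p \<longleftrightarrow> x = y" "s p x \<noteq> s y p" "s y p \<noteq> s p x"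
  using schedule_inject[OF assms(1,2), of x y] assms by auto

lemma schedule_opponent:
  assumes "schedule n s" "p \<in> teams n" "k \<in> slots n"
  shows "\<exists>q\<in>teams n - {p}. s p q = k \<or> s q p = k"
proof -
  have "incident s p ` (UNIV \<times> (teams n - {p})) = slots n"
  proof (rule card_subset_eq)
    show "incident s p ` (UNIV \<times> (teams n - {p})) \<subseteq> slots n"
      using assms unfolding schedule_def by blast
    have "inj_on (incident s p) (UNIV \<times> (teams n - {p}))"
      using assms unfolding schedule_def by blast
    then show "card (incident s p ` (UNIV \<times> (teams n - {p}))) = card (slots n)"
      using assms(2) by (simp add: card_image card_cartesian_product teams_def slots_def)
  qed (simp add: slots_def)
  with assms(3) have "k \<in> incident s p ` (UNIV \<times> (teams n - {p}))" by simp
  then obtain b q where "q \<in> teams n - {p}" "k = incident s p (b, q)" by blast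
  then show ?thesis by (auto simp: incident_def split: if_splits)
qed

definition matches_of :: "nat \<Rightarrow> (nat \<Rightarrow> nat \<Rightarrow> nat) \<Rightarrow> (nat \<times> nat \<times> nat) set" where
  "matches_of n s = {(k, p, q). (p, q) \<in> arcs n \<and> s p q = k}"

lemma tournament_matches_of:
  assumes s: "schedule n s"
  shows "tournament n (matches_of n s)"
  unfolding tournament_def
proof (intro conjI ballI impI)
  show "matches_of n s \<subseteq> matches n"
    using schedule_range[OF s] by (auto simp: matches_of_def matches_def)
next
  fix k i assume ki: "k \<in> slots n" "i \<in> teams n"
  obtain q where q: "q \<in> teams n - {i}" "s i q = k \<or> s q i = k"
    using schedule_opponent[OF s ki(2,1)] by blast
  have "indicator (matches_of n s) (k, i, j) + indicator (matches_of n s) (k, j, i)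
      = (if j = q then 1 else (0::real))" if j: "j \<in> teams n - {i}" for j
  proof -
    note schedule_inject[OF s ki(2) j q(1)] schedule_inject[OF s ki(2) q(1) j]
      schedule_inject(3)[OF s ki(2) j j]
    then show ?thesis
      using q(2) j ki by (auto simp: indicator_def matches_of_def arcs_def)
  qed
  then have "(\<Sum>j\<in>teams n - {i}. indicator (matches_of n s) (k, i, j) +
      indicator (matches_of n s) (k, j, i)) = (\<Sum>j\<in>teams n - {i}. if j = q then 1 else (0::real))"
    by (intro sum.cong) simp_all
  also have "\<dots> = 1" using q(1) by (simp add: teams_def)
  finally show "(\<Sum>j\<in>teams n - {i}. indicator (matches_of n s) (k, i, j) +
      indicator (matches_of n s) (k, j, i)) = (1::real)" .
next
  fix x assume x: "x \<in> arcs n"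
  obtain i j where ij: "x = (i, j)" by fastforce
  have "(\<Sum>k\<in>slots n. indicator (matches_of n s) (k, i, j))
      = (\<Sum>k\<in>slots n. if k = s i j then 1 else (0::real))"
    using x by (intro sum.cong) (auto simp: ij indicator_def matches_of_def)
  also have "\<dots> = 1" using schedule_range[OF s, of i j] x by (simp add: ij slots_def)
  finally show "case x of (i, j) \<Rightarrow> (\<Sum>k\<in>slots n. indicator (matches_of n s) (k, i, j)) = (1::real)"
    by (simp add: ij)
qed

text \<open>The permutation may depend on the team: the defining condition concerns one team at a
  time, and the two teams of a match agree on its slot because \<open>s'\<close> is a function of
  the match.\<close>

lemma schedule_permute_slots:
  assumes s: "schedule n s"
    and h: "\<And>p. p \<in> teams n \<Longrightarrow> \<exists>h. h permutes slots n \<and>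
      (\<forall>q\<in>teams n - {p}. s' p q = h (s p q) \<and> s' q p = h (s q p))"
  shows "schedule n s'"
  unfolding schedule_def
proof (intro ballI)
  fix p assume p: "p \<in> teams n"
  let ?D = "UNIV \<times> (teams n - {p})"
  obtain h where h: "h permutes slots n"
    "\<And>q. q \<in> teams n - {p} \<Longrightarrow> s' p q = h (s p q) \<and> s' q p = h (s q p)"
    using h[OF p] by blast
  have eq: "incident s' p x = (h \<circ> incident s p) x" if "x \<in> ?D" for x
    using that h(2) by (cases x) (simp add: incident_def)
  have sp: "inj_on (incident s p) ?D" "incident s p ` ?D \<subseteq> slots n"
    using s p unfolding schedule_def by blast+
  have "inj_on (h \<circ> incident s p) ?D"
    using sp(1) permutes_inj[OF h(1)] by (metis comp_inj_on inj_on_subset subset_UNIV)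
  moreover have "(h \<circ> incident s p) ` ?D \<subseteq> slots n"
    using sp(2) permutes_image[OF h(1)] by (metis image_comp image_mono)
  ultimately show "inj_on (incident s' p) ?D \<and> incident s' p ` ?D \<subseteq> slots n"
    using eq by (metis (no_types, lifting) image_cong inj_on_cong)
qed

definition swap_venues :: "nat \<Rightarrow> nat \<Rightarrow> (nat \<Rightarrow> nat \<Rightarrow> nat) \<Rightarrow> nat \<Rightarrow> nat \<Rightarrow> nat" where
  "swap_venues p q s = (\<lambda>x y. if (x, y) = (p, q) \<or> (x, y) = (q, p) then s y x else s x y)"

text \<open>For \<open>p\<close> and \<open>q\<close> the exchange transposes the slots of their two
  mutual matches, which hold no other match of either; the remaining teams see no change.\<close>

lemma schedule_swap_venues:
  assumes s: "schedule n s" and pq: "(p, q) \<in> arcs n"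
  shows "schedule n (swap_venues p q s)"
proof (rule schedule_permute_slots[OF s])
  fix v assume v: "v \<in> teams n"
  have pq': "p \<in> teams n" "q \<in> teams n" "p \<noteq> q" "(q, p) \<in> arcs n" using pq by (auto simp: arcs_def)
  show "\<exists>h. h permutes slots n \<and> (\<forall>u\<in>teams n - {v}. swap_venues p q s v u = h (s v u) \<and>
      swap_venues p q s u v = h (s u v))"
  proof (cases "v \<in> {p, q}")
    case True
    define w where "w = (if v = p then q else p)"
    have w: "w \<in> teams n - {v}" "{v, w} = {p, q}" using True pq' by (auto simp: w_def)
    have "swap_venues p q s v u = Transposition.transpose (s v w) (s w v) (s v u) \<and>
      swap_venues p q s u v = Transposition.transpose (s v w) (s w v) (s u v)"
      if u: "u \<in> teams n - {v}" for u
    proof (cases "u = w")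
      case True
      then show ?thesis using w(2) by (auto simp: swap_venues_def doubleton_eq_iff)
    next
      case False
      then have "swap_venues p q s v u = s v u" "swap_venues p q s u v = s u v"
        using w u by (auto simp: swap_venues_def doubleton_eq_iff)
      moreover have "s v u \<notin> {s v w, s w v}" "s u v \<notin> {s v w, s w v}"
        using schedule_inject[OF s v w(1) u] schedule_inject[OF s v u w(1)] False by auto
      ultimately show ?thesis by (simp add: Transposition.transpose_def)
    qed
    moreover have "Transposition.transpose (s v w) (s w v) permutes slots n"
      using schedule_range[OF s] w v by (intro permutes_swap_id) (auto simp: arcs_def)
    ultimately show ?thesis by blast
  next
    case False
    then show ?thesis by (intro exI[of _ id]) (auto simp: swap_venues_def permutes_id)
  qed
qed

definition swap_slots_on ::
  "(nat \<times> nat) set \<Rightarrow> nat \<Rightarrow> nat \<Rightarrow> (nat \<Rightarrow> nat \<Rightarrow> nat) \<Rightarrow> nat \<Rightarrow> nat \<Rightarrow> nat" where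
  "swap_slots_on C e f s = (\<lambda>x y. if (x, y) \<in> C then Transposition.transpose e f (s x y) else s x y)"

lemma swap_slots_on_eq:
  "(x, y) \<in> C \<or> s x y \<notin> {e, f} \<Longrightarrow> swap_slots_on C e f s x y = Transposition.transpose e f (s x y)"
  by (auto simp: swap_slots_on_def)

text \<open>Each of the four teams has one cycle match in \<open>e\<close> and one in
  \<open>f\<close>, hence no other match there. On all its matches the exchange therefore acts as
  the transposition of \<open>e\<close> and \<open>f\<close>.\<close>

lemma schedule_swap_cycle:
  assumes s: "schedule n s" and m: "{t, a, b, d} \<subseteq> teams n" "distinct [t, a, b, d]"
    and e: "s t a = e" "s b d = e" and f: "s t d = f" "s a b = f"
  shows "schedule n (swap_slots_on {(t, a), (b, d), (t, d), (a, b)} e f s)" (is "schedule n ?s'")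
proof (rule schedule_permute_slots[OF s])
  fix v assume v: "v \<in> teams n"
  show "\<exists>h. h permutes slots n \<and> (\<forall>u\<in>teams n - {v}. ?s' v u = h (s v u) \<and> ?s' u v = h (s u v))"
  proof (cases "v \<in> {t, a, b, d}")
    case True
    have "?s' v u = Transposition.transpose e f (s v u) \<and> ?s' u v = Transposition.transpose e f (s u v)"
      if u: "u \<in> teams n - {v}" for u
    proof -
      have 1: "(s v u \<notin> {e, f} \<or> (v, u) \<in> {(t, a), (b, d), (t, d), (a, b)}) \<and>
          (s u v \<notin> {e, f} \<or> (u, v) \<in> {(t, a), (b, d), (t, d), (a, b)})"
      proof -
        consider "v = t" | "v = a" | "v = b" | "v = d" using True by blast
        then show ?thesis
        proof cases
          case 1
          then show ?thesis
            unfolding e(1)[symmetric] f(1)[symmetric] using u m by (auto simp: schedule_eq_iff[OF s])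
        next
          case 2
          then show ?thesis
            unfolding e(1)[symmetric] f(2)[symmetric] using u m by (auto simp: schedule_eq_iff[OF s])
        next
          case 3
          then show ?thesis
            unfolding e(2)[symmetric] f(2)[symmetric] using u m by (auto simp: schedule_eq_iff[OF s])
        next
          case 4
          have "s d u \<noteq> s b d" "s d u \<noteq> s t d" "s u d = s b d \<longleftrightarrow> u = b" "s u d = s t d \<longleftrightarrow> u = t"
            using u m 4 by (simp_all add: schedule_eq_iff[OF s])
          then show ?thesis
            unfolding e(2)[symmetric] f(1)[symmetric] 4 by blast
        qed
      qed
      show ?thesis using 1 by (intro conjI swap_slots_on_eq) blast+
    qed
    moreover have "Transposition.transpose e f permutes slots n"
      using schedule_range[OF s, of t a] schedule_range[OF s, of t d] m e f
      by (intro permutes_swap_id) (auto simp: arcs_def)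
    ultimately show ?thesis by blast
  next
    case False
    then show ?thesis by (intro exI[of _ id]) (auto simp: swap_slots_on_def permutes_id)
  qed
qed

definition schedule_value :: "nat \<Rightarrow> (nat \<Rightarrow> nat \<Rightarrow> nat \<Rightarrow> real) \<Rightarrow> (nat \<Rightarrow> nat \<Rightarrow> nat) \<Rightarrow> real" where
  "schedule_value n w s = (\<Sum>(p, q)\<in>arcs n. w (s p q) p q)"

lemma schedule_value_diff:
  assumes "C \<subseteq> arcs n" "\<And>p q. (p, q) \<in> arcs n - C \<Longrightarrow> s p q = s' p q"
  shows "schedule_value n w s - schedule_value n w s' = (\<Sum>(p, q)\<in>C. w (s p q) p q - w (s' p q) p q)"
proof -
  have "schedule_value n w s - schedule_value n w s'
      = (\<Sum>(p, q)\<in>arcs n. w (s p q) p q - w (s' p q) p q)"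
    by (simp add: schedule_value_def sum_subtractf case_prod_unfold)
  also have "\<dots> = (\<Sum>(p, q)\<in>C. w (s p q) p q - w (s' p q) p q)"
    using assms by (intro sum.mono_neutral_right) (auto simp: finite_arcs)
  finally show ?thesis .
qed

subsection \<open>Functionals constant on the face\<close>

text \<open>There are 2n - 2 >= 6 slots.\<close>

lemma spare_slot:
  assumes "4 \<le> n" "length xs \<le> 5"
  shows "\<exists>g\<in>slots n. g \<notin> set xs"
proof (rule ccontr)
  assume "\<not> ?thesis"
  then have "card (slots n) \<le> card (set xs)" by (intro card_mono) auto
  then show False using assms card_length[of xs] by (simp add: slots_def)
qed

text \<open>With \<open>P\<close> and \<open>Q\<close> the slots in which \<open>t\<close> plays at venues \<open>I\<close> and \<open>J\<close>, this says that the
  schedule lies on the face; \<open>R\<close> is the neighbour of the slot \<open>K\<close> other than \<open>L\<close>.\<close>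

definition tight :: "nat \<Rightarrow> nat \<Rightarrow> nat \<Rightarrow> nat \<Rightarrow> nat \<Rightarrow> bool" where
  "tight K L R P Q \<longleftrightarrow> P = K \<or> Q = L \<or> (Q = K \<and> P \<noteq> R)"

locale tight_functional =
  fixes n K L R I J t :: nat and w :: "nat \<Rightarrow> nat \<Rightarrow> nat \<Rightarrow> real" and c :: real
  assumes n: "even n" "4 \<le> n"
    and teams: "{I, J, t} \<subseteq> teams n" "distinct [I, J, t]"
    and slots: "{K, L} \<subseteq> slots n" "distinct [K, L, R]"
    and const: "\<And>s. schedule n s \<Longrightarrow> tight K L R (s I t) (s J t) \<Longrightarrow> schedule_value n w s = c"
begin

section \<open>Venue exchanges: home-away differences do not depend on the slot\<close>

definition skew where
  "skew e p q = w e p q - w e q p"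

lemma skew_commute: "skew e q p = - skew e p q"
  by (simp add: skew_def)

text \<open>The exchange trades w e p q + w f q p for w f p q + w e q p, and both schedules have the
  value \<open>c\<close>.\<close>

lemma skew_swap_venues:
  assumes s: "schedule n s" and pq: "(p, q) \<in> arcs n" and ef: "s p q = e" "s q p = f"
    and t: "tight K L R (s I t) (s J t)"
      "tight K L R (swap_venues p q s I t) (swap_venues p q s J t)"
  shows "skew e p q = skew f p q"
proof -
  have ne: "p \<noteq> q" "(q, p) \<in> arcs n" using pq by (auto simp: arcs_def)
  have "schedule_value n w s - schedule_value n w (swap_venues p q s) = 0"
    using const[OF s t(1)] const[OF schedule_swap_venues[OF s pq] t(2)] by simp
  also have "schedule_value n w s - schedule_value n w (swap_venues p q s)
      = (\<Sum>(x, y)\<in>{(p, q), (q, p)}. w (s x y) x y - w (swap_venues p q s x y) x y)"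
    using pq ne by (intro schedule_value_diff) (auto simp: swap_venues_def)
  also have "\<dots> = skew e p q - skew f p q"
    using ne ef by (simp add: swap_venues_def skew_def)
  finally show ?thesis by simp
qed

text \<open>The visit to \<open>I\<close> stays pinned in \<open>K\<close>; a match sharing a team
  with it can use every slot but \<open>K\<close>. The version for \<open>J\<close> pins its visit
  in \<open>L\<close>.\<close>

lemma skew_of_shared_I:
  assumes pq: "(p, q) \<in> arcs n" "{p, q} \<noteq> {I, t}" "{p, q} \<inter> {I, t} \<noteq> {}"
    and ef: "{e, f} \<subseteq> slots n - {K}"
  shows "skew e p q = skew f p q"
proof (cases "e = f")
  case False
  have "\<exists>s. schedule n s \<and> s p q = e \<and> s q p = f \<and> s I t = K"
    using n pq ef teams slots False by (intro schedule_share_vertex) (auto simp: arcs_def)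
  then obtain s where s: "schedule n s" "s p q = e" "s q p = f" "s I t = K" by blast
  have "swap_venues p q s I t = s I t" using pq(2) by (auto simp: swap_venues_def)
  then show ?thesis using s pq by (intro skew_swap_venues[OF s(1)]) (auto simp: tight_def)
qed simp

lemma skew_of_shared_J:
  assumes pq: "(p, q) \<in> arcs n" "{p, q} \<noteq> {J, t}" "{p, q} \<inter> {J, t} \<noteq> {}"
    and ef: "{e, f} \<subseteq> slots n - {L}"
  shows "skew e p q = skew f p q"
proof (cases "e = f")
  case False
  have "\<exists>s. schedule n s \<and> s p q = e \<and> s q p = f \<and> s J t = L"
    using n pq ef teams slots False by (intro schedule_share_vertex) (auto simp: arcs_def)
  then obtain s where s: "schedule n s" "s p q = e" "s q p = f" "s J t = L" by blast
  have "swap_venues p q s J t = s J t" using pq(2) by (auto simp: swap_venues_def)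
  then show ?thesis using s pq by (intro skew_swap_venues[OF s(1)]) (auto simp: tight_def)
qed simp

text \<open>A match avoiding \<open>I\<close> and \<open>t\<close> can be played in \<open>K\<close>
  beside the pinned one, so \<open>K\<close> itself serves as the reference slot.\<close>

lemma skew_disjoint_I:
  assumes pq: "(p, q) \<in> arcs n" "{p, q} \<inter> {I, t} = {}" and f: "f \<in> slots n"
  shows "skew K p q = skew f p q"
proof (cases "K = f")
  case False
  have "\<exists>s. schedule n s \<and> s p q = K \<and> s q p = f \<and> s I t = K"
    using n pq f teams slots False by (intro schedule_disjoint_edges) (auto simp: arcs_def)
  then obtain s where s: "schedule n s" "s p q = K" "s q p = f" "s I t = K" by blast
  have "swap_venues p q s I t = s I t" using pq(2) by (auto simp: swap_venues_def)
  then show ?thesis using s pq by (intro skew_swap_venues[OF s(1)]) (auto simp: tight_def)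
qed simp

lemma skew_disjoint_J:
  assumes pq: "(p, q) \<in> arcs n" "{p, q} \<inter> {J, t} = {}" and f: "f \<in> slots n"
  shows "skew L p q = skew f p q"
proof (cases "L = f")
  case False
  have "\<exists>s. schedule n s \<and> s p q = L \<and> s q p = f \<and> s J t = L"
    using n pq f teams slots False by (intro schedule_disjoint_edges) (auto simp: arcs_def)
  then obtain s where s: "schedule n s" "s p q = L" "s q p = f" "s J t = L" by blast
  have "swap_venues p q s J t = s J t" using pq(2) by (auto simp: swap_venues_def)
  then show ?thesis using s pq by (intro skew_swap_venues[OF s(1)]) (auto simp: tight_def)
qed simp

lemma skew_I:
  assumes ef: "{e, f} \<subseteq> slots n"
  shows "skew e I t = skew f I t"
proof -
  have arc: "(I, t) \<in> arcs n" using teams by (auto simp: arcs_def)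
  have off_L: "skew e I t = skew f I t" if "{e, f} \<subseteq> slots n - {L}" for e f
    using skew_of_shared_J[OF arc _ _ that] teams by (auto simp: doubleton_eq_iff)
  obtain g where g: "g \<in> slots n" "g \<notin> {K, L, R}"
    using spare_slot[of n "[K, L, R]"] n by auto
  \<comment> \<open>Slot \<open>L\<close> is blocked by the pin on \<open>J\<close>. Here
    \<open>J\<close> is visited in \<open>K\<close> instead, and the visit to \<open>I\<close> moves
    from \<open>L\<close> to \<open>g\<close>, neither of which is \<open>R\<close>: both schedules
    satisfy the third alternative of \<open>tight\<close>.\<close>
  have "\<exists>s. schedule n s \<and> s I t = L \<and> s t I = g \<and> s J t = K"
    using n g teams slots by (intro schedule_share_vertex) (auto simp: doubleton_eq_iff)
  then obtain s where s: "schedule n s" "s I t = L" "s t I = g" "s J t = K" by blast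
  have "skew L I t = skew g I t"
    using s teams slots g
    by (intro skew_swap_venues[OF s(1) arc]) (auto simp: tight_def swap_venues_def)
  then have *: "skew e I t = skew g I t" if "e \<in> slots n" for e
    using off_L[of e g] that g by (cases "e = L") auto
  show ?thesis using *[of e] *[of f] ef by simp
qed

lemma skew_J:
  assumes ef: "{e, f} \<subseteq> slots n"
  shows "skew e J t = skew f J t"
proof -
  have arc: "(J, t) \<in> arcs n" using teams by (auto simp: arcs_def)
  have off_K: "skew e J t = skew f J t" if "{e, f} \<subseteq> slots n - {K}" for e f
    using skew_of_shared_I[OF arc _ _ that] teams by (auto simp: doubleton_eq_iff)
  obtain g where g: "g \<in> slots n" "g \<notin> {K, L, R}"
    using spare_slot[of n "[K, L, R]"] n by auto
  \<comment> \<open>The visit to \<open>J\<close> will move from \<open>K\<close> to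
    \<open>L\<close>, which passes from the third alternative of \<open>tight\<close> to the
    second.\<close>
  have "\<exists>s. schedule n s \<and> s J t = K \<and> s t J = L \<and> s I t = g"
  proof (rule schedule_share_vertex[OF n])
    show "{J, t} \<noteq> {I, t}" using teams by (simp add: doubleton_eq_iff)
  qed (use teams slots g in auto)
  then obtain s where s: "schedule n s" "s J t = K" "s t J = L" "s I t = g" by blast
  have "skew K J t = skew L J t"
    using s teams slots g
    by (intro skew_swap_venues[OF s(1) arc]) (auto simp: tight_def swap_venues_def)
  then have *: "skew e J t = skew L J t" if "e \<in> slots n" for e
    using off_K[of e L] that slots by (cases "e = K") auto
  show ?thesis using *[of e] *[of f] ef by simp
qed

lemma skew_constant:
  assumes pq: "(p, q) \<in> arcs n" and ef: "{e, f} \<subseteq> slots n"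
  shows "skew e p q = skew f p q"
proof -
  consider "{p, q} \<inter> {I, t} = {}" | "{p, q} \<inter> {J, t} = {}" | "{p, q} = {I, t}" | "{p, q} = {J, t}"
    | "{p, q} \<inter> {I, t} \<noteq> {}" "{p, q} \<inter> {J, t} \<noteq> {}" "{p, q} \<noteq> {I, t}" "{p, q} \<noteq> {J, t}"
    by blast
  then show ?thesis
  proof cases
    case 1
    then show ?thesis using skew_disjoint_I[OF pq, of e] skew_disjoint_I[OF pq, of f] ef by simp
  next
    case 2
    then show ?thesis using skew_disjoint_J[OF pq, of e] skew_disjoint_J[OF pq, of f] ef by simp
  next
    case 3
    then show ?thesis using skew_I[OF ef] skew_commute[of _ I t] by (auto simp: doubleton_eq_iff)
  next
    case 4
    then show ?thesis using skew_J[OF ef] skew_commute[of _ J t] by (auto simp: doubleton_eq_iff)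
  next
    \<comment> \<open>These are the matches between \<open>I\<close> and \<open>J\<close> and those
      of \<open>t\<close> with a fourth team. Each pin forbids only its own slot, so a slot outside
      \<open>K\<close> and \<open>L\<close> links all others.\<close>
    case 5
    obtain g where g: "g \<in> slots n" "g \<notin> {K, L}"
      using spare_slot[of n "[K, L]"] n by auto
    have *: "skew e p q = skew g p q" if "e \<in> slots n" for e
    proof (cases "e = K")
      case True
      then show ?thesis using skew_of_shared_J[OF pq 5(4,2), of e g] g slots by auto
    next
      case False
      then show ?thesis using skew_of_shared_I[OF pq 5(3,1), of e g] g that by auto
    qed
    show ?thesis using *[of e] *[of f] ef by simp
  qed
qed

section \<open>Slot exchanges: splitting slot differences over the two teams\<close>

definition slot_diff where
  "slot_diff e f p q = w e p q - w f p q"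

text \<open>A rearrangement of \<open>skew_constant\<close>; from here on slot differences are
  functions of undirected edges.\<close>

lemma slot_diff_commute:
  assumes "(p, q) \<in> arcs n" "{e, f} \<subseteq> slots n"
  shows "slot_diff e f q p = slot_diff e f p q"
  using skew_constant[OF assms] by (simp add: slot_diff_def skew_def)

text \<open>\<open>t\<close> hosts both of its cycle matches but is the visitor in the pinned one.
  Hence the pinned match is not moved, even if \<open>x\<close> lies on the cycle.\<close>

lemma slot_diff_four_cycle_away_fixed:
  assumes ef: "{e, f} \<subseteq> slots n" "e \<noteq> f" and g: "g \<in> slots n - {e, f}"
    and x: "x = I \<and> g = K \<or> x = J \<and> g = L"
    and m: "{a, b, d} \<subseteq> teams n" "distinct [t, a, b, d]"
  shows "slot_diff e f t a + slot_diff e f b d = slot_diff e f t d + slot_diff e f a b"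
proof -
  let ?C = "{(t, a), (b, d), (t, d), (a, b)}"
  have "\<exists>s. schedule n s \<and> s t a = e \<and> s b d = e \<and> s t d = f \<and> s a b = f \<and> s x t = g"
    using n ef g x m teams by (intro schedule_four_cycle) auto
  then obtain s where s: "schedule n s" and e: "s t a = e" "s b d = e"
    and f: "s t d = f" "s a b = f" and xt: "s x t = g" by blast
  let ?s' = "swap_slots_on ?C e f s"
  have s': "schedule n ?s'"
    using m teams by (intro schedule_swap_cycle[OF s _ _ e f]) auto
  have "?s' x t = s x t" using x m teams by (auto simp: swap_slots_on_def)
  then have "tight K L R (s I t) (s J t)" "tight K L R (?s' I t) (?s' J t)"
    using x xt by (auto simp: tight_def)
  then have "schedule_value n w s - schedule_value n w ?s' = 0"
    using const[OF s] const[OF s'] by simp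
  also have "schedule_value n w s - schedule_value n w ?s'
      = (\<Sum>(x, y)\<in>?C. w (s x y) x y - w (?s' x y) x y)"
    using m teams by (intro schedule_value_diff) (auto simp: swap_slots_on_def arcs_def)
  also have "\<dots> = slot_diff e f t a + slot_diff e f b d - slot_diff e f t d - slot_diff e f a b"
    using m e f by (simp add: swap_slots_on_def slot_diff_def)
  finally show ?thesis by simp
qed

text \<open>Both pins are blocked only if \<open>e\<close> and \<open>f\<close> are \<open>K\<close>
  and \<open>L\<close>; the difference is then split at a third slot.\<close>

lemma slot_diff_four_cycle:
  assumes ef: "{e, f} \<subseteq> slots n" and m: "{a, b, d} \<subseteq> teams n" "distinct [t, a, b, d]"
  shows "slot_diff e f t a + slot_diff e f b d = slot_diff e f t d + slot_diff e f a b"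
proof -
  have *: "slot_diff e f t a + slot_diff e f b d = slot_diff e f t d + slot_diff e f a b"
    if "{e, f} \<subseteq> slots n" "K \<notin> {e, f} \<or> L \<notin> {e, f}" for e f
  proof (cases "e = f")
    case False
    then show ?thesis
      using slot_diff_four_cycle_away_fixed[of e f K I a b d] slot_diff_four_cycle_away_fixed[of e f L J a b d]
        that m slots by auto
  qed (simp add: slot_diff_def)
  obtain g where g: "g \<in> slots n" "g \<notin> {K, L}"
    using spare_slot[of n "[K, L]"] n by auto
  have add: "slot_diff e f p q = slot_diff e g p q + slot_diff g f p q" for p q
    by (simp add: slot_diff_def)
  show ?thesis
    unfolding add using *[of e g] *[of g f] ef g slots by auto
qed

text \<open>Only 4-cycles through \<open>t\<close> are available, since in other cases the matches between \<open>I\<close> or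
  \<open>J\<close> and \<open>t\<close> may be forced into the exchanged slots; they suffice.\<close>

lemma slot_diff_decompose:
  assumes ef: "{e, f} \<subseteq> slots n"
  shows "\<exists>u. \<forall>(p, q)\<in>arcs n. slot_diff e f p q = u p + u q"
proof -
  define D where "D p q = slot_diff e f p q" for p q
  have sym: "D p q = D q p" if "p \<in> teams n" "q \<in> teams n" "p \<noteq> q" for p q
    unfolding D_def using that by (intro slot_diff_commute[symmetric] ef) (auto simp: arcs_def)
  \<comment> \<open>The cycle relation says that \<open>E p q\<close> does not change when one end
    is replaced; by symmetry it is constant on the edges avoiding \<open>t\<close>.\<close>
  define E where "E p q = D p q - D t p - D t q" for p q
  let ?V = "teams n - {t}"
  have share: "E p q = E p q'" if "{p, q, q'} \<subseteq> ?V" "p \<noteq> q" "p \<noteq> q'" for p q q'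
  proof (cases "q = q'")
    case False
    have "D t q' + D p q = D t q + D q' p"
      unfolding D_def using that False by (intro slot_diff_four_cycle ef) auto
    then show ?thesis using sym[of q' p] that by (auto simp: E_def)
  qed simp
  have Esym: "E p q = E q p" if "{p, q} \<subseteq> ?V" "p \<noteq> q" for p q
    using sym[of p q] that by (auto simp: E_def)
  define c0 where "c0 = E I J"
  have all: "E p q = c0" if pq: "{p, q} \<subseteq> ?V" "p \<noteq> q" for p q
  proof (cases "p = I")
    case True
    then show ?thesis using share[of I q J] pq teams by (auto simp: c0_def)
  next
    case False
    have "E p q = E p I" using share[of p q I] pq teams False by auto
    also have "\<dots> = E I p" using Esym[of p I] pq teams False by auto
    also have "\<dots> = c0" using share[of I p J] pq teams False by (auto simp: c0_def)
    finally show ?thesis .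
  qed
  \<comment> \<open>Half of \<open>c0\<close> at each end adds up to \<open>c0\<close> on edges
    avoiding \<open>t\<close>; the value at \<open>t\<close> cancels the half on the edges through
    \<open>t\<close>.\<close>
  define u where "u p = (if p = t then - c0 / 2 else D t p + c0 / 2)" for p
  have "D p q = u p + u q" if pq: "(p, q) \<in> arcs n" for p q
  proof -
    consider "p = t" | "q = t" "p \<noteq> t" | "p \<noteq> t" "q \<noteq> t" by blast
    then show ?thesis
    proof cases
      case 1
      then show ?thesis using pq by (auto simp: u_def arcs_def)
    next
      case 2
      then show ?thesis using sym[of p q] pq by (auto simp: u_def arcs_def)
    next
      case 3
      then have "E p q = c0" using pq by (intro all) (auto simp: arcs_def)
      then show ?thesis using 3 by (simp add: u_def E_def)
    qed
  qed
  then show ?thesis by (auto simp: D_def)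
qed

text \<open>Tournaments satisfy the slot equations by definition only from slot 2 on, hence the
  normalization of \<open>u\<close> in slot 1.\<close>

lemma functional_decompose:
  "\<exists>u v. (\<forall>p. u 1 p = 0) \<and>
     (\<forall>e\<in>slots n. \<forall>(p, q)\<in>arcs n. w e p q = u e p + u e q + v p q)"
proof -
  have one: "1 \<in> slots n" using n by (auto simp: slots_def)
  have "\<forall>e\<in>slots n. \<exists>u. \<forall>(p, q)\<in>arcs n. slot_diff e 1 p q = u p + u q"
    using one by (intro ballI slot_diff_decompose) auto
  then obtain u where u: "\<forall>e\<in>slots n. \<forall>(p, q)\<in>arcs n. slot_diff e 1 p q = u e p + u e q"
    by (auto dest!: bchoice)
  define u' where "u' e p = (if e = 1 then 0 else u e p)" for e p
  have "w e p q = u' e p + u' e q + w 1 p q" if "e \<in> slots n" "(p, q) \<in> arcs n" for e p q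
    using u that by (fastforce simp: u'_def slot_diff_def)
  moreover have "u' 1 p = 0" for p by (simp add: u'_def)
  ultimately show ?thesis by (intro exI[of _ u'] exI[of _ "w 1"]) blast
qed

end

subsection \<open>Tournaments and travels\<close>

lemma sum_eq_one_unique:
  fixes g :: "'a \<Rightarrow> real"
  assumes "sum g A = 1" "finite A" "\<And>x. x \<in> A \<Longrightarrow> 0 \<le> g x" "x \<in> A" "y \<in> A" "1 \<le> g x" "1 \<le> g y"
  shows "x = y"
proof (rule ccontr)
  assume "x \<noteq> y"
  then have "g x + g y = sum g {x, y}" by simp
  also have "\<dots> \<le> sum g A" using assms by (intro sum_mono2) auto
  finally show False using assms by simp
qed

text \<open>Only slot 1 needs an argument: by the arc equations a team has 2(n - 1) matches in
  total, and the other 2n - 3 slots take one each.\<close>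

lemma tournament_slot_sum:
  assumes T: "tournament n T" and n: "2 \<le> n" and k: "k \<in> slots n" and i: "i \<in> teams n"
  shows "(\<Sum>j\<in>teams n - {i}. indicator T (k, i, j) + indicator T (k, j, i)) = (1::real)"
proof -
  let ?S = "\<lambda>k. \<Sum>j\<in>teams n - {i}. indicator T (k, i, j) + indicator T (k, j, i) :: real"
  have ge2: "?S k = 1" if "k \<in> slots n" "2 \<le> k" for k
    using T that i unfolding tournament_def by blast
  have arc: "(\<Sum>k\<in>slots n. indicator T (k, p, q)) = (1::real)" if "(p, q) \<in> arcs n" for p q
    using T that unfolding tournament_def by blast
  have "(\<Sum>k\<in>slots n. ?S k) = (\<Sum>j\<in>teams n - {i}. (\<Sum>k\<in>slots n. indicator T (k, i, j)) +
      (\<Sum>k\<in>slots n. indicator T (k, j, i)))"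
    by (subst sum.swap) (simp add: sum.distrib)
  also have "\<dots> = (\<Sum>j\<in>teams n - {i}. 2)"
    using i by (intro sum.cong refl) (auto simp: arc arcs_def)
  also have "\<dots> = 2 * (real n - 1)"
    using i n by (simp add: teams_def of_nat_diff)
  finally have total: "(\<Sum>k\<in>slots n. ?S k) = 2 * (real n - 1)" .
  have one: "1 \<in> slots n" using n by (simp add: slots_def)
  have "(\<Sum>k\<in>slots n. ?S k) = ?S 1 + (\<Sum>k\<in>slots n - {1}. ?S k)"
    using one by (intro sum.remove) (simp_all add: slots_def)
  also have "(\<Sum>k\<in>slots n - {1}. ?S k) = (\<Sum>k\<in>slots n - {1}. 1)"
    by (intro sum.cong refl ge2) (auto simp: slots_def)
  also have "\<dots> = 2 * real n - 3"
    using one n by (simp add: slots_def of_nat_diff)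
  finally have "?S 1 = 1" using total by simp
  then show ?thesis using ge2[OF k] k by (cases "k = 1") (auto simp: slots_def)
qed

lemma tournament_match_unique:
  assumes T: "tournament n T" and "(k, i, j) \<in> T" "(k', i, j) \<in> T"
  shows "k = k'"
proof -
  have m: "(i, j) \<in> arcs n" "k \<in> slots n" "k' \<in> slots n"
    using assms unfolding tournament_def matches_def by auto
  have "(\<Sum>k\<in>slots n. indicator T (k, i, j)) = (1::real)"
    using T m unfolding tournament_def by blast
  then show ?thesis
    by (rule sum_eq_one_unique) (use m assms in \<open>auto simp: slots_def\<close>)
qed

lemma tournament_venue_unique:
  assumes T: "tournament n T" and n: "2 \<le> n" and "(k, i, t) \<in> T" "(k, j, t) \<in> T"
  shows "i = j"
proof -
  have m: "(i, t) \<in> arcs n" "(j, t) \<in> arcs n" "k \<in> slots n"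
    using assms unfolding tournament_def matches_def by auto
  then have t: "t \<in> teams n" by (simp add: arcs_def)
  show ?thesis
    by (rule sum_eq_one_unique[OF tournament_slot_sum[OF T n m(3) t]])
      (use m assms in \<open>auto simp: teams_def arcs_def\<close>)
qed

text \<open>\<open>J\<close> hosts \<open>t\<close> only once, and \<open>t\<close> visits only one
  venue in slot \<open>K\<close>. So the sum reaches two only with \<open>I\<close> in
  \<open>K\<close> and \<open>J\<close> in \<open>L\<close>, which is the travel from
  \<open>a\<close> to \<open>b\<close>.\<close>

lemma travel_inequality:
  assumes T: "tournament n T" and n: "2 \<le> n" and K: "K \<in> slots n" "L \<in> slots n"
    and IJ: "I \<noteq> J"
    and ab: "L = K + 1 \<and> (a, b) = (I, J) \<or> K = L + 1 \<and> (a, b) = (J, I)"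
  shows "indicator T (K, J, t) + indicator T (K, I, t) + indicator T (L, J, t)
    \<le> 1 + (of_bool (travels n T t a b) :: real)"
proof -
  have 1: "\<not> ((K, J, t) \<in> T \<and> (L, J, t) \<in> T)"
    using tournament_match_unique[OF T, of K J t L] ab by auto
  have 2: "\<not> ((K, J, t) \<in> T \<and> (K, I, t) \<in> T)"
    using tournament_venue_unique[OF T n, of K J t I] IJ by auto
  have 3: "travels n T t a b" if "(K, I, t) \<in> T" "(L, J, t) \<in> T"
  proof -
    have "at_venue n T t K I" "at_venue n T t L J" using that K by (auto simp: at_venue_def)
    moreover have "K \<in> {0..2 * n - 2}" "L \<in> {0..2 * n - 2}" using K by (auto simp: slots_def)
    ultimately show ?thesis using ab IJ unfolding travels_def by auto
  qed
  show ?thesis using 1 2 3 by (auto simp: indicator_def)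
qed

section \<open>Functionals constant on all tournaments\<close>

lemma sum_arcs: "(\<Sum>(p, q)\<in>arcs n. g p q) = (\<Sum>p\<in>teams n. \<Sum>q\<in>teams n - {p}. g p q)"
proof -
  have "arcs n = (SIGMA p:teams n. teams n - {p})" by (auto simp: arcs_def)
  then show ?thesis by (simp add: sum.Sigma teams_def)
qed

lemma sum_arcs_swap: "(\<Sum>(p, q)\<in>arcs n. g q p) = (\<Sum>(p, q)\<in>arcs n. g p q)"
  by (rule sum.reindex_bij_witness[where i = prod.swap and j = prod.swap]) (auto simp: arcs_def)

text \<open>Such a functional is a combination of the tournament equations: \<open>u k p\<close>
  weighs the equation of team \<open>p\<close> in slot \<open>k\<close>, and \<open>v p q\<close>
  that of the arc.\<close>

lemma tournament_value_constant:
  fixes u :: "nat \<Rightarrow> nat \<Rightarrow> real"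
  assumes T: "tournament n T"
    and u: "\<And>p. u 1 p = 0"
    and w: "\<And>k p q. k \<in> slots n \<Longrightarrow> (p, q) \<in> arcs n \<Longrightarrow> w k p q = u k p + u k q + v p q"
  shows "(\<Sum>(k, p, q)\<in>matches n. w k p q * indicator T (k, p, q))
    = (\<Sum>k\<in>slots n. \<Sum>p\<in>teams n. u k p) + (\<Sum>(p, q)\<in>arcs n. v p q)"
proof -
  let ?i = "\<lambda>k p q. indicator T (k, p, q) :: real"
  have "(\<Sum>(k, p, q)\<in>matches n. w k p q * ?i k p q)
      = (\<Sum>k\<in>slots n. \<Sum>(p, q)\<in>arcs n. w k p q * ?i k p q)"
    by (simp add: matches_def sum.cartesian_product case_prod_unfold)
  also have "\<dots> = (\<Sum>k\<in>slots n. (\<Sum>(p, q)\<in>arcs n. u k p * ?i k p q) + (\<Sum>(p, q)\<in>arcs n. u k q * ?i k p q)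
      + (\<Sum>(p, q)\<in>arcs n. v p q * ?i k p q))"
    unfolding sum.distrib[symmetric] by (intro sum.cong refl) (auto simp: w algebra_simps)
  also have "\<dots> = (\<Sum>k\<in>slots n. \<Sum>p\<in>teams n. u k p) + (\<Sum>k\<in>slots n. \<Sum>(p, q)\<in>arcs n. v p q * ?i k p q)"
  proof -
    have "(\<Sum>(p, q)\<in>arcs n. u k p * ?i k p q) + (\<Sum>(p, q)\<in>arcs n. u k q * ?i k p q)
        = (\<Sum>p\<in>teams n. u k p)" if k: "k \<in> slots n" for k
    proof -
      have "(\<Sum>(p, q)\<in>arcs n. u k q * ?i k p q) = (\<Sum>(p, q)\<in>arcs n. u k p * ?i k q p)"
        by (rule sum_arcs_swap)
      then have "(\<Sum>(p, q)\<in>arcs n. u k p * ?i k p q) + (\<Sum>(p, q)\<in>arcs n. u k q * ?i k p q)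
          = (\<Sum>p\<in>teams n. u k p * (\<Sum>q\<in>teams n - {p}. ?i k p q + ?i k q p))"
        by (simp add: sum_arcs sum.distrib[symmetric] sum_distrib_left distrib_left)
      also have "\<dots> = (\<Sum>p\<in>teams n. u k p)"
      proof (intro sum.cong refl)
        fix p assume p: "p \<in> teams n"
        show "u k p * (\<Sum>q\<in>teams n - {p}. ?i k p q + ?i k q p) = u k p"
        proof (cases "2 \<le> k")
          case True
          then have "(\<Sum>q\<in>teams n - {p}. ?i k p q + ?i k q p) = 1"
            using T k p unfolding tournament_def by blast
          then show ?thesis by simp
        next
          case False
          then have "k = 1" using k by (auto simp: slots_def)
          then show ?thesis by (simp only: u mult_zero_left)
        qed
      qed
      finally show ?thesis .
    qed
    then show ?thesis by (simp add: sum.distrib)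
  qed
  also have "(\<Sum>k\<in>slots n. \<Sum>(p, q)\<in>arcs n. v p q * ?i k p q)
      = (\<Sum>(p, q)\<in>arcs n. v p q * (\<Sum>k\<in>slots n. ?i k p q))"
    by (subst sum.swap) (simp add: sum_distrib_left case_prod_unfold)
  also have "\<dots> = (\<Sum>(p, q)\<in>arcs n. v p q)"
  proof (intro sum.cong refl)
    fix x assume "x \<in> arcs n"
    moreover obtain p q where "x = (p, q)" by fastforce
    ultimately show "(case x of (p, q) \<Rightarrow> v p q * (\<Sum>k\<in>slots n. ?i k p q)) = (case x of (p, q) \<Rightarrow> v p q)"
      using T unfolding tournament_def by fastforce
  qed
  finally show ?thesis .
qed

lemma schedule_value_eq:
  assumes s: "schedule n s"
  shows "schedule_value n w s = (\<Sum>(k, p, q)\<in>matches n. w k p q * indicator (matches_of n s) (k, p, q))"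
proof -
  have "(\<Sum>(k, p, q)\<in>matches n. w k p q * indicator (matches_of n s) (k, p, q))
      = (\<Sum>k\<in>slots n. \<Sum>(p, q)\<in>arcs n. w k p q * indicator (matches_of n s) (k, p, q))"
    by (simp add: matches_def sum.cartesian_product case_prod_unfold)
  also have "\<dots> = (\<Sum>k\<in>slots n. \<Sum>(p, q)\<in>arcs n. if k = s p q then w k p q else 0)"
    by (intro sum.cong refl) (auto simp: matches_of_def indicator_def)
  also have "\<dots> = (\<Sum>(p, q)\<in>arcs n. \<Sum>k\<in>slots n. if k = s p q then w k p q else 0)"
    by (subst sum.swap) (simp add: case_prod_unfold)
  also have "\<dots> = schedule_value n w s"
    unfolding schedule_value_def
    using schedule_range[OF s] by (intro sum.cong refl) (auto simp: slots_def)
  finally show ?thesis by simp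
qed

section \<open>Schedules on the face that avoid a given travel\<close>

lemma at_venue_away:
  assumes "at_venue n (matches_of n s) t p i" "i \<noteq> t"
  shows "s i t = p"
  using assms by (auto simp: at_venue_def matches_of_def split: if_splits)

lemma not_at_home:
  assumes s: "schedule n s" and m: "x \<in> teams n" "t \<in> teams n" "x \<noteq> t"
  shows "\<not> at_venue n (matches_of n s) t (s x t) t"
proof -
  have "s x t \<in> slots n" using schedule_range[OF s] m by (simp add: arcs_def)
  moreover have "s t j \<noteq> s x t" if "(t, j) \<in> arcs n" for j
    using schedule_eq_iff(3)[OF s m(2), of j x] m that by (auto simp: arcs_def)
  ultimately show ?thesis by (auto simp: at_venue_def matches_of_def arcs_def)
qed

text \<open>Each venue is visited once, and start and end are at home, so the travel means s b t = s
  a t + 1. The first two alternatives of \<open>tight\<close> then complete the pattern; the third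
  would put the visit to \<open>I\<close> into the slot it excludes.\<close>

lemma tight_travels:
  assumes tight: "tight K L (2 * K - L) (s I t) (s J t)" and K: "1 \<le> K" and t: "t \<notin> {I, J}"
    and ab: "L = K + 1 \<and> (a, b) = (I, J) \<or> K = L + 1 \<and> (a, b) = (J, I)"
    and tr: "travels n (matches_of n s) t a b"
  shows "s I t = K \<and> s J t = L"
proof -
  obtain p where "at_venue n (matches_of n s) t p a" "at_venue n (matches_of n s) t (p + 1) b"
    using tr unfolding travels_def by blast
  then have "s b t = s a t + 1"
    using at_venue_away[of n s t] ab t by auto
  then show ?thesis using ab tight K by (auto simp: tight_def)
qed

text \<open>At least one of the two possible pins is not the visit of \<open>t'\<close> to
  \<open>y\<close>; it is used. A further venue \<open>x\<close> outside \<open>y\<close>,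
  \<open>t'\<close> and the pinned host exists because n >= 4, and both visits of \<open>t'\<close>
  can go to any slots avoiding the pin.\<close>

lemma tight_schedule_away:
  assumes n: "even n" "4 \<le> n" and m: "{I, J, t} \<subseteq> teams n" "distinct [I, J, t]"
    and y: "y \<in> teams n" "t' \<in> teams n" "y \<noteq> t'"
  shows "\<exists>x\<in>teams n - {y, t'}. \<exists>g\<in>{K, L}. \<forall>q q'. {g, q, q'} \<subseteq> slots n \<and> distinct [g, q, q'] \<longrightarrow>
    (\<exists>s. schedule n s \<and> tight K L R (s I t) (s J t) \<and> s y t' = q \<and> s x t' = q')"
proof -
  obtain h g where h: "h = I \<and> g = K \<or> h = J \<and> g = L" "(h, t) \<noteq> (y, t')"
    using m by (cases "y = I") auto
  have "card {t', y, h} < card (teams n)"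
    using n card_insert_le_m1[of 3 "{y, h}" t'] card_insert_le_m1[of 2 "{h}" y] by (auto simp: teams_def)
  then obtain x where x: "x \<in> teams n" "x \<notin> {t', y, h}"
    by (metis card_mono finite.emptyI finite_insert linorder_not_le subsetI)
  have "\<exists>s. schedule n s \<and> tight K L R (s I t) (s J t) \<and> s y t' = q \<and> s x t' = q'"
    if q: "{g, q, q'} \<subseteq> slots n" "distinct [g, q, q']" for q q'
  proof -
    have "\<exists>s. schedule n s \<and> s h t = g \<and> s y t' = q \<and> s x t' = q'"
      using n q x y h m by (intro schedule_three_arcs) auto
    then show ?thesis using h(1) by (auto simp: tight_def)
  qed
  then show ?thesis using x h(1) by (intro bexI[of _ x] bexI[of _ g]) auto
qed

lemma tight_schedule_not_travelling:
  assumes n: "even n" "4 \<le> n" and m: "{I, J, t} \<subseteq> teams n" "distinct [I, J, t]"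
    and K: "{K, L} \<subseteq> slots n"
    and ij: "t' \<in> teams n" "(i, j) \<in> arcs n"
  shows "\<exists>s. schedule n s \<and> tight K L R (s I t) (s J t) \<and> \<not> travels n (matches_of n s) t' i j"
proof -
  have ij': "i \<in> teams n" "j \<in> teams n" "i \<noteq> j" using ij by (auto simp: arcs_def)
  have adjacent: "\<exists>q. {q, Suc q} \<subseteq> slots n \<and> g \<notin> {q, Suc q}" for g
    using n by (intro exI[of _ "if g \<le> 2 then 3 else 1"]) (auto simp: slots_def)
  consider "i = t'" | "j = t'" | "t' \<notin> {i, j}" "t' = t" "{i, j} = {I, J}"
    | "t' \<notin> {i, j}" "\<not> (t' = t \<and> {i, j} = {I, J})" by blast
  then show ?thesis
  proof cases
    \<comment> \<open>To keep \<open>t'\<close> from reaching \<open>j\<close> from home, it visits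
      \<open>x\<close> right before its only visit to \<open>j\<close>.\<close>
    case 1
    have "j \<noteq> t'" using ij' 1 by simp
    from tight_schedule_away[OF n m ij'(2) ij(1) this, of K L R]
    obtain x g where x: "x \<in> teams n - {j, t'}" "g \<in> {K, L}"
      and ex: "\<forall>q q'. {g, q, q'} \<subseteq> slots n \<and> distinct [g, q, q'] \<longrightarrow>
        (\<exists>s. schedule n s \<and> tight K L R (s I t) (s J t) \<and> s j t' = q \<and> s x t' = q')"
      by (elim bexE) (rule that)
    obtain q where q: "{q, Suc q} \<subseteq> slots n" "g \<notin> {q, Suc q}" using adjacent by blast
    obtain s where s: "schedule n s" "tight K L R (s I t) (s J t)" "s j t' = Suc q" "s x t' = q"
      using ex[rule_format, of "Suc q" q] q x K by auto
    have "\<not> travels n (matches_of n s) t' i j"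
      using at_venue_away[of n s t' _ j] not_at_home[OF s(1), of x t'] s(3,4) x ij(1) ij'(3) 1
      by (auto simp: travels_def)
    then show ?thesis using s by blast
  next
    \<comment> \<open>The mirror image: \<open>t'\<close> visits \<open>x\<close> right after its
      only visit to \<open>i\<close>.\<close>
    case 2
    have "i \<noteq> t'" using ij' 2 by simp
    from tight_schedule_away[OF n m ij'(1) ij(1) this, of K L R]
    obtain x g where x: "x \<in> teams n - {i, t'}" "g \<in> {K, L}"
      and ex: "\<forall>q q'. {g, q, q'} \<subseteq> slots n \<and> distinct [g, q, q'] \<longrightarrow>
        (\<exists>s. schedule n s \<and> tight K L R (s I t) (s J t) \<and> s i t' = q \<and> s x t' = q')"
      by (elim bexE) (rule that)
    obtain q where q: "{q, Suc q} \<subseteq> slots n" "g \<notin> {q, Suc q}" using adjacent by blast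
    obtain s where s: "schedule n s" "tight K L R (s I t) (s J t)" "s i t' = q" "s x t' = Suc q"
      using ex[rule_format, of q "Suc q"] q x K by auto
    have "\<not> travels n (matches_of n s) t' i j"
      using at_venue_away[of n s t' _ i] not_at_home[OF s(1), of x t'] s(3,4) x ij(1) ij'(3) 2
      by (auto simp: travels_def)
    then show ?thesis using s by blast
  next
    \<comment> \<open>The travel is between the two pinned venues themselves: \<open>I\<close> is
      pinned in \<open>K\<close>, and \<open>J\<close> is placed away from the neighbours of
      \<open>K\<close>.\<close>
    case 3
    obtain g where g: "g \<in> slots n" "g \<notin> {K, K + 1, K - 1}"
      using spare_slot[of n "[K, K + 1, K - 1]"] n by auto
    obtain f where f: "f \<in> slots n" "f \<notin> {K, g}"
      using spare_slot[of n "[K, g]"] n by auto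
    have "\<exists>s. schedule n s \<and> s I t = K \<and> s t I = f \<and> s J t = g"
    proof (rule schedule_share_vertex[OF n])
      show "{I, t} \<noteq> {J, t}" using m by (simp add: doubleton_eq_iff)
    qed (use m K f g in auto)
    then obtain s where s: "schedule n s" "s I t = K" "s J t = g" by blast
    have "\<not> travels n (matches_of n s) t' i j"
    proof
      assume "travels n (matches_of n s) t' i j"
      then have "s j t = s i t + 1"
        using at_venue_away[of n s t'] 3(1,2) by (auto simp: travels_def)
      then show False using s g 3(3) by (auto simp: doubleton_eq_iff)
    qed
    then show ?thesis using s by (auto simp: tight_def)
  next
    \<comment> \<open>Some pin is neither of the two visits, which can then be placed so that
      \<open>j\<close> does not come right after \<open>i\<close>.\<close>
    case 4
    obtain h g where h: "h = I \<and> g = K \<or> h = J \<and> g = L" "(h, t) \<notin> {(i, t'), (j, t')}"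
      using 4(2) m by (cases "t' = t"; cases "I \<in> {i, j}") auto
    have gK: "g \<in> slots n" using h K by auto
    obtain q where q: "q \<in> slots n" "q \<notin> {g}"
      using spare_slot[of n "[g]"] n by auto
    obtain q' where q': "q' \<in> slots n" "q' \<notin> {g, q, q + 1}"
      using spare_slot[of n "[g, q, q + 1]"] n by auto
    have "\<exists>s. schedule n s \<and> s h t = g \<and> s i t' = q \<and> s j t' = q'"
      using n q q' gK ij ij' h m 4(1) by (intro schedule_three_arcs) auto
    then obtain s where s: "schedule n s" "s h t = g" "s i t' = q" "s j t' = q'" by blast
    have "\<not> travels n (matches_of n s) t' i j"
    proof
      assume "travels n (matches_of n s) t' i j"
      then have "s j t' = s i t' + 1"
        using at_venue_away[of n s t'] 4(1) by (auto simp: travels_def)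
      then show False using s q' by auto
    qed
    then show ?thesis using s h(1) by (auto simp: tight_def)
  qed
qed

subsection \<open>The polytope\<close>

lemma Rep_Abs_match_idx:
  "(k, i, j) \<in> matches CARD('n) \<Longrightarrow> Rep_match_idx (Abs_match_idx (k, i, j) :: 'n::card2 match_idx) = (k, i, j)"
  by (rule Abs_match_idx_inverse)

lemma sum_match_idx:
  "(\<Sum>m\<in>(UNIV :: 'n::card2 match_idx set). g (Rep_match_idx m)) = (\<Sum>x\<in>matches CARD('n). g x)"
  by (rule sum.reindex_bij_betw)
    (simp add: bij_betw_def Rep_match_idx_inject inj_on_def type_definition.Rep_range[OF type_definition_match_idx])

lemma inner_incidence_vec:
  "\<alpha> \<bullet> (incidence_vec T :: real ^ 'n::card2 match_idx)
    = (\<Sum>(k, p, q)\<in>matches CARD('n). \<alpha> $ Abs_match_idx (k, p, q) * indicator T (k, p, q))"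
proof -
  have "\<alpha> \<bullet> (incidence_vec T :: real ^ 'n match_idx)
      = (\<Sum>m\<in>(UNIV :: 'n match_idx set). \<alpha> $ Abs_match_idx (Rep_match_idx m) * indicator T (Rep_match_idx m))"
    by (simp only: inner_vec_def incidence_vec_def Rep_match_idx_inverse vec_lambda_beta inner_real_def)
  also have "\<dots> = (\<Sum>x\<in>matches CARD('n). \<alpha> $ Abs_match_idx x * indicator T x)"
    by (rule sum_match_idx)
  finally show ?thesis by (simp add: case_prod_unfold)
qed

definition vertex :: "(nat \<Rightarrow> nat \<Rightarrow> nat) \<Rightarrow> 'n::card2 travel_idx set \<Rightarrow> 'n utt_space" where
  "vertex s Y = (incidence_vec (matches_of CARD('n) s), \<chi> l. of_bool (l \<in> Y))"

lemma vertex_in_P_utt: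
  fixes Y :: "'n::card2 travel_idx set"
  assumes s: "schedule CARD('n) s"
    and Y: "\<And>l t i j. l \<notin> Y \<Longrightarrow> Rep_travel_idx l = (t, i, j) \<Longrightarrow> \<not> travels CARD('n) (matches_of CARD('n) s) t i j"
  shows "vertex s Y \<in> P_utt"
proof -
  have "travel_vec (matches_of CARD('n) s) $ l \<le> (of_bool (l \<in> Y) :: real)" for l :: "'n travel_idx"
    using Y[of l] by (cases "Rep_travel_idx l") (auto simp: travel_vec_def)
  then show ?thesis
    unfolding P_utt_def vertex_def
    by (intro hull_inc CollectI exI conjI refl) (auto simp: tournament_matches_of[OF s])
qed

lemma x_coord_vertex:
  assumes "(k, i, j) \<in> matches CARD('n::card2)"
  shows "x_coord (vertex s (Y :: 'n travel_idx set)) k i j = of_bool (s i j = k)"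
  using assms
  by (auto simp: x_coord_def vertex_def incidence_vec_def Rep_Abs_match_idx indicator_def matches_of_def matches_def)

lemma y_coord_vertex:
  "y_coord (vertex s Y) t i j = of_bool (Abs_travel_idx (t, i, j) \<in> Y)"
  by (simp add: y_coord_def vertex_def)

text \<open>Isolates a single travel coefficient: it vanishes if the functional agrees at both
  points.\<close>

lemma inner_vertex_remove:
  assumes "l \<in> Y"
  shows "A \<bullet> vertex s Y = A \<bullet> vertex s (Y - {l}) + snd A $ l"
proof -
  have eq: "(\<chi> k. of_bool (k \<in> Y)) = (\<chi> k. of_bool (k \<in> Y - {l})) + (axis l 1 :: real ^ _)"
    using assms by (auto simp: vec_eq_iff axis_def)
  show ?thesis
    unfolding vertex_def inner_prod_def by (simp add: eq inner_add_right inner_axis)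
qed

text \<open>The two inequalities of the theorem are the cases \<open>L = K + 1\<close> and \<open>K = L + 1\<close>; they are exchanged
  by reversing time.\<close>

lemma travel_inequality_facet_defining:
  fixes K L I J t a b :: nat
  defines "f \<equiv> \<lambda>z :: 'n::card2 utt_space. x_coord z K J t + x_coord z K I t + x_coord z L J t - 1"
  defines "g \<equiv> \<lambda>z :: 'n utt_space. y_coord z t a b"
  assumes n: "even CARD('n)" "4 \<le> CARD('n)"
    and K: "{K, L} \<subseteq> slots CARD('n)"
    and m: "{I, J, t} \<subseteq> teams CARD('n)" "distinct [I, J, t]"
    and ab: "L = K + 1 \<and> (a, b) = (I, J) \<or> K = L + 1 \<and> (a, b) = (J, I)"
  shows "facet_defining P_utt f g"
proof -
  let ?n = "CARD('n)"
  let ?P = "P_utt :: 'n utt_space set"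
  \<comment> \<open>\<open>L\<close> reflected at \<open>K\<close>. At either end of the season this
    is 0 or 2n - 1, which is not a slot, and the condition on \<open>R\<close> is vacuous.\<close>
  let ?R = "2 * K - L"
  define F where "F = {z \<in> ?P. f z = g z}"
  define l0 where "l0 = (Abs_travel_idx (t, a, b) :: 'n travel_idx)"
  have l0: "Rep_travel_idx l0 = (t, a, b)"
    unfolding l0_def using m ab by (intro Abs_travel_idx_inverse) (auto simp: arcs_def)
  have mem: "(K, J, t) \<in> matches ?n" "(K, I, t) \<in> matches ?n" "(L, J, t) \<in> matches ?n"
    using K m by (auto simp: matches_def arcs_def)
  \<comment> \<open>The constant -1 is left out, so the face is where the inner product with
    \<open>N\<close> equals 1.\<close>
  define N :: "'n utt_space" where "N = (axis (Abs_match_idx (K, J, t)) 1 + axis (Abs_match_idx (K, I, t)) 1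
    + axis (Abs_match_idx (L, J, t)) 1, - axis l0 1)"
  have N: "N \<bullet> z = f z - g z + 1" for z
    by (simp add: N_def f_def g_def x_coord_def y_coord_def l0_def inner_prod_def inner_add_left inner_axis')

  have valid: "N \<bullet> z \<le> 1" if "z \<in> ?P" for z
  proof -
    have "?P \<subseteq> {z. N \<bullet> z \<le> 1}"
      unfolding P_utt_def
    proof (rule hull_minimal)
      show "{(incidence_vec T, y) | T y. tournament ?n T \<and> (\<forall>l. y $ l \<in> {0, 1}) \<and>
          (\<forall>l. travel_vec T $ l \<le> y $ l)} \<subseteq> {z. N \<bullet> z \<le> 1}"
      proof clarify
        fix T :: "(nat \<times> nat \<times> nat) set" and y :: "real ^ 'n travel_idx"
        assume T: "tournament ?n T" and y: "\<forall>l. travel_vec T $ l \<le> y $ l"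
        have "of_bool (travels ?n T t a b) \<le> y $ l0"
          using y[rule_format, of l0] by (simp add: travel_vec_def l0)
        moreover have "indicator T (K, J, t) + indicator T (K, I, t) + indicator T (L, J, t)
            \<le> 1 + (of_bool (travels ?n T t a b) :: real)"
          using n K m ab by (intro travel_inequality[OF T]) auto
        moreover have "x_coord (incidence_vec T, y) k i j = indicator T (k, i, j)"
          if "(k, i, j) \<in> matches ?n" for k i j
          using that by (simp add: x_coord_def incidence_vec_def Rep_Abs_match_idx)
        moreover have "y_coord (incidence_vec T, y) t a b = y $ l0"
          by (simp add: y_coord_def l0_def)
        ultimately show "N \<bullet> (incidence_vec T, y) \<le> 1"
          unfolding N f_def g_def using mem by simp
      qed
    qed (rule convex_halfspace_le)
    then show ?thesis using that by auto
  qed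
  have convex: "convex ?P" by (simp add: P_utt_def)
  have face: "F face_of ?P"
  proof -
    have "F = ?P \<inter> {z. N \<bullet> z = 1}" by (auto simp: F_def N)
    then show ?thesis using face_of_Int_supporting_hyperplane_le[OF convex valid] by simp
  qed

  \<comment> \<open>The travel part is as large as the face permits: all ones, except that the
    coordinate \<open>l0\<close> equals the left side of the inequality. Only the travel from
    \<open>a\<close> to \<open>b\<close> then needs checking.\<close>
  define Y where "Y s = (if s I t = K \<and> s J t = L then UNIV else UNIV - {l0})" for s
  have vertex_F: "vertex s Z \<in> F"
    if s: "schedule ?n s" "tight K L ?R (s I t) (s J t)"
      and Z: "\<And>l t i j. l \<notin> Z \<Longrightarrow> l \<noteq> l0 \<Longrightarrow> Rep_travel_idx l = (t, i, j) \<Longrightarrow>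
        \<not> travels ?n (matches_of ?n s) t i j"
      and l0Z: "l0 \<in> Z \<longleftrightarrow> s I t = K \<and> s J t = L" for s and Z :: "'n travel_idx set"
  proof -
    have "\<not> travels ?n (matches_of ?n s) t a b" if "l0 \<notin> Z"
      using that tight_travels[where n = ?n and s = s and t = t and I = I and J = J and K = K and L = L
        and a = a and b = b] s(2) ab K m l0Z by (auto simp: slots_def)
    then have "vertex s Z \<in> ?P"
      using Z l0 by (intro vertex_in_P_utt[OF s(1)]) (metis prod.inject)
    moreover have "s I t \<noteq> s J t"
      using schedule_eq_iff(2)[OF s(1), of t I J] m by auto
    moreover have "K \<noteq> L" using ab by auto
    ultimately show ?thesis
      unfolding F_def f_def g_def
      using s(2) l0Z mem by (auto simp: x_coord_vertex y_coord_vertex l0_def[symmetric] tight_def)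
  qed
  have vertex_Y: "vertex s (Y s) \<in> F" if "schedule ?n s" "tight K L ?R (s I t) (s J t)" for s
    by (rule vertex_F[OF that]) (auto simp: Y_def split: if_splits)

  \<comment> \<open>Without the travel from \<open>a\<close> to \<open>b\<close>, the coordinate
    \<open>l0\<close> may be 0 or 1: the value prescribed by \<open>Y\<close> gives a face point,
    the value 1 gives a point with slack one.\<close>
  obtain s0 where s0: "schedule ?n s0" "tight K L ?R (s0 I t) (s0 J t)"
    "\<not> travels ?n (matches_of ?n s0) t a b"
    using tight_schedule_not_travelling[OF n m K, of t a b ?R] m ab by (auto simp: arcs_def)
  define z0 where "z0 = (vertex s0 UNIV :: 'n utt_space)"
  have "\<not> (s0 I t = K \<and> s0 J t = L)"
  proof
    assume *: "s0 I t = K \<and> s0 J t = L"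
    then have "at_venue ?n (matches_of ?n s0) t K I" "at_venue ?n (matches_of ?n s0) t L J"
      using K m by (auto simp: at_venue_def matches_of_def arcs_def)
    moreover have "K \<in> {0..2 * ?n - 2}" "L \<in> {0..2 * ?n - 2}" using K by (auto simp: slots_def)
    ultimately show False using s0(3) ab m unfolding travels_def by auto
  qed
  then have Y0: "Y s0 = UNIV - {l0}" unfolding Y_def by (rule if_not_P)
  have z0: "z0 \<in> ?P" "z0 \<notin> F"
  proof -
    show "z0 \<in> ?P" unfolding z0_def by (rule vertex_in_P_utt[OF s0(1)]) simp
    have "N \<bullet> z0 = N \<bullet> vertex s0 (Y s0) - 1"
      unfolding z0_def Y0 using inner_vertex_remove[of l0 UNIV N s0] by (simp add: N_def)
    moreover have "N \<bullet> vertex s0 (Y s0) = 1"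
      using vertex_Y[OF s0(1,2)] by (simp add: N F_def)
    ultimately have "N \<bullet> z0 = 0" by simp
    then show "z0 \<notin> F" by (auto simp: F_def N)
  qed

  have hull: "?P \<subseteq> affine hull (insert z0 F)"
  proof (rule ccontr)
    assume "\<not> ?thesis"
    then obtain z where z: "z \<in> ?P" "z \<notin> affine hull (insert z0 F)" by blast
    obtain H where H: "affine hull (insert z0 F) = \<Inter>H" "\<And>h. h \<in> H \<Longrightarrow> \<exists>A c. A \<noteq> 0 \<and> h = {x. A \<bullet> x = c}"
      using affine_hull_finite_intersection_hyperplanes[of "insert z0 F"] by metis
    then obtain h where h: "h \<in> H" "z \<notin> h" using z by auto
    then obtain A c where A: "h = {x. A \<bullet> x = c}" using H(2) by blast
    have "insert z0 F \<subseteq> h" using H(1) h(1) hull_subset[of "insert z0 F" affine] by auto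
    then have Az0: "A \<bullet> z0 = c" and AF: "\<And>z. z \<in> F \<Longrightarrow> A \<bullet> z = c" by (auto simp: A)
    have "snd A $ l = 0" for l
    \<comment> \<open>For \<open>l0\<close> the compared points are \<open>z0\<close> and its
      neighbour on the face; for any other travel they are two face points of a schedule avoiding
      that travel.\<close>
    proof (cases "l = l0")
      case True
      then show ?thesis
        using inner_vertex_remove[of l0 UNIV A s0] Az0 AF[OF vertex_Y[OF s0(1,2)]]
        by (simp add: z0_def Y0)
    next
      case False
      obtain t' i j where l: "Rep_travel_idx l = (t', i, j)" using prod_cases3 by blast
      then have "t' \<in> teams ?n" "(i, j) \<in> arcs ?n" using Rep_travel_idx[of l] by auto
      then obtain s where s: "schedule ?n s" "tight K L ?R (s I t) (s J t)"
        "\<not> travels ?n (matches_of ?n s) t' i j"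
        using tight_schedule_not_travelling[OF n m K, of t' i j ?R] by blast
      have "vertex s (Y s - {l}) \<in> F"
      proof (rule vertex_F[OF s(1,2)])
        fix k u p q
        assume "k \<notin> Y s - {l}" "k \<noteq> l0" "Rep_travel_idx k = (u, p, q)"
        then show "\<not> travels ?n (matches_of ?n s) u p q"
          using s(3) l by (auto simp: Y_def split: if_splits)
      qed (use False in \<open>auto simp: Y_def\<close>)
      moreover have "l \<in> Y s" using False by (simp add: Y_def)
      ultimately show ?thesis
        using inner_vertex_remove[of l "Y s" A s] AF vertex_Y[OF s(1,2)] by simp
    qed
    then have "snd A = 0" by (simp add: vec_eq_iff)
    then have Afst: "A \<bullet> x = fst A \<bullet> fst x" for x by (simp add: inner_prod_def)
    define w where "w k p q = fst A $ Abs_match_idx (k, p, q)" for k p q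
    have val: "A \<bullet> (incidence_vec T, y) = (\<Sum>(k, p, q)\<in>matches ?n. w k p q * indicator T (k, p, q))" for T y
      by (simp add: Afst inner_incidence_vec w_def)
    have sval: "schedule_value ?n w s = c" if "schedule ?n s" "tight K L ?R (s I t) (s J t)" for s
      using AF[OF vertex_Y[OF that]] val schedule_value_eq[OF that(1), of w] by (simp add: vertex_def)
    interpret tight_functional ?n K L ?R I J t w c
      using n m K ab sval by unfold_locales (auto simp: slots_def)
    obtain u v where u: "\<And>p. u 1 p = 0"
      and uv: "\<And>e p q. e \<in> slots ?n \<Longrightarrow> (p, q) \<in> arcs ?n \<Longrightarrow> w e p q = u e p + u e q + v p q"
      using functional_decompose by blast
    have cT: "A \<bullet> (incidence_vec T, y) = c" if T: "tournament ?n T" for T y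
      using tournament_value_constant[where w = w and u = u and v = v, OF T u uv]
        tournament_value_constant[where w = w and u = u and v = v, OF tournament_matches_of[OF s0(1)] u uv]
        sval[OF s0(1,2)] schedule_value_eq[OF s0(1), of w] val by simp
    have "?P \<subseteq> h"
      unfolding P_utt_def A using cT by (intro hull_minimal) (auto simp: convex_hyperplane)
    then show False using z(1) h(2) by blast
  qed
  \<comment> \<open>One extra point raises the dimension by at most one, and a proper face has
    smaller dimension.\<close>
  have "aff_dim ?P \<le> aff_dim (insert z0 F)"
    using aff_dim_subset[OF hull] by simp
  also have "\<dots> \<le> aff_dim F + 1" by (simp add: aff_dim_insert)
  finally have "aff_dim ?P \<le> aff_dim F + 1" .
  moreover have "aff_dim F < aff_dim ?P"
    using z0 by (intro face_of_aff_dim_lt[OF convex face]) auto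
  ultimately have "F facet_of ?P"
    using face vertex_Y[OF s0(1,2)] by (auto simp: facet_of_def)
  moreover have "f z \<le> g z" if "z \<in> ?P" for z using valid[OF that] by (simp add: N)
  ultimately show ?thesis by (simp add: facet_defining_def F_def)
qed

theorem theorem9:
  fixes k i j t :: nat
  assumes "even CARD('n::card2)" and "4 \<le> CARD('n)"
    and "k \<in> slots CARD('n) - {2 * CARD('n) - 2}"
    and "i \<in> teams CARD('n)" and "j \<in> teams CARD('n)" and "t \<in> teams CARD('n)"
    and "i \<noteq> j" and "i \<noteq> t" and "j \<noteq> t"
  shows "facet_defining (P_utt :: 'n utt_space set)
           (\<lambda>z. x_coord z k j t + x_coord z k i t + x_coord z (k + 1) j t - 1)
           (\<lambda>z. y_coord z t i j)
       \<and> facet_defining (P_utt :: 'n utt_space set)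
           (\<lambda>z. x_coord z (k + 1) i t + x_coord z k i t + x_coord z (k + 1) j t - 1)
           (\<lambda>z. y_coord z t i j)"
proof
  have slots: "{k, k + 1} \<subseteq> slots CARD('n)" using assms(3) by (auto simp: slots_def)
  show "facet_defining (P_utt :: 'n utt_space set)
      (\<lambda>z. x_coord z k j t + x_coord z k i t + x_coord z (k + 1) j t - 1) (\<lambda>z. y_coord z t i j)"
    using assms slots by (intro travel_inequality_facet_defining) auto
  \<comment> \<open>The time-reversed case: \<open>K\<close>, \<open>L\<close> are
    \<open>k + 1\<close>, \<open>k\<close>, and \<open>I\<close>, \<open>J\<close> are
    \<open>j\<close>, \<open>i\<close>.\<close>
  have "facet_defining (P_utt :: 'n utt_space set)
      (\<lambda>z. x_coord z (k + 1) i t + x_coord z (k + 1) j t + x_coord z k i t - 1) (\<lambda>z. y_coord z t i j)"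
    using assms slots by (intro travel_inequality_facet_defining) auto
  then show "facet_defining (P_utt :: 'n utt_space set)
      (\<lambda>z. x_coord z (k + 1) i t + x_coord z k i t + x_coord z (k + 1) j t - 1) (\<lambda>z. y_coord z t i j)"
    by (simp add: algebra_simps)
qed

end
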